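(* Let $n,m,k$ be positive integers, $\Lambda=[\lambda_1\dots\lambda_m]^T$ and $R=[r_1\dots r_k]^T$ positive integer vectors, and $H=[h_1\dots h_m]^T$ integers with $1\le h_1<h_2<\dots<h_m\le n$. (a) $\Lambda K_n^H$ is $R$-factorable if and only if $\sum_{i\in[m]}\lambda_i\binom{n-1}{h_i-1}=\sum_{i\in[k]}r_i$ and there exists a non-negative integer $k\times m$ matrix $A=[a_{ij}]$ with $AH=nR$ (i.e. $\sum_{j\in[m]}a_{ij}h_j=nr_i$ for all $i\in[k]$) and $\sum_{i\in[k]}a_{ij}=\lambda_j\binom{n}{h_j}$ for all $j\in[m]$. (b) If $\{F_1,\dots,F_k\}$ is an $R$-factorization of $\Lambda K_n^H$ and $a_{ij}$ denotes the number of edges of size $h_j$ in $F_i$, then $A=[a_{ij}]$ satisfies the conditions in (a), and for each $i\in[k]$ such that $F_i$ is connected, $\sum_{j\in[m]}a_{ij}\le n(r_i-1)+1$. (c) Conversely, if the equality and the matrix $A$ of (a) exist, then there is an $R$-factorization $\{F_1,\dots,F_k\}$ of $\Lambda K_n^H$ in which, for all $i,j$, $F_i$ has exactly $a_{ij}$ edges of size $h_j$, and $F_i$ is connected for every $i\in[k]$ with $\sum_{j\in[m]}a_{ij}\le n(r_i-1)+1$.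
   Context: $\Lambda K_n^H=\bigcup_{i\in[m]}\lambda_iK_n^{h_i}$ is the hypergraph on $n$ vertices in which, for each $i\in[m]$, every $h_i$-element subset of vertices is an edge of multiplicity $\lambda_i$ (and there are no other edges). Degree of a vertex is the number of edges containing it. An $r$-factor is a spanning sub-hypergraph in which every vertex has degree $r$. An $R$-factorization of a hypergraph is a partition $\{F_1,\dots,F_k\}$ of its edge multiset such that $F_i$ (with all vertices) is an $r_i$-factor for each $i\in[k]$. *)

theory Defs
  imports Complex_Main "HOL-Library.Multiset"
begin

text \<open>
  A hypergraph is given by a vertex set \<open>V\<close> and a multiset \<open>E\<close> of edges, each edge a subset of \<open>V\<close>;
  the multiplicity of an edge \<open>e\<close> is \<open>count E e\<close>. Vectors and matrices are functions on \<open>nat\<close>,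
  of which only the values at the (1-based) indices in range are used.
\<close>

definition complete_hypergraph ::
  "'a set \<Rightarrow> nat \<Rightarrow> (nat \<Rightarrow> nat) \<Rightarrow> (nat \<Rightarrow> nat) \<Rightarrow> 'a set multiset" where
  "complete_hypergraph V m lam h =
     (\<Sum>i\<in>{1..m}. repeat_mset (lam i) (mset_set {e. e \<subseteq> V \<and> card e = h i}))"

definition hdegree :: "'a set multiset \<Rightarrow> 'a \<Rightarrow> nat" where
  "hdegree E v = size {#e \<in># E. v \<in> e#}"

text \<open>Spanning sub-hypergraphs keep the whole vertex set, so they are given by their edges alone.\<close>

definition is_factor :: "'a set \<Rightarrow> 'a set multiset \<Rightarrow> nat \<Rightarrow> 'a set multiset \<Rightarrow> bool" where
  "is_factor V E r F \<longleftrightarrow> F \<subseteq># E \<and> (\<forall>v\<in>V. hdegree F v = r)"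

text \<open>
  A partition of an edge multiset is a family of sub-multisets whose multiset sum is the whole,
  i.e. the multiplicities of each edge add up.
\<close>

definition is_factorization ::
  "'a set \<Rightarrow> 'a set multiset \<Rightarrow> nat \<Rightarrow> (nat \<Rightarrow> nat) \<Rightarrow> (nat \<Rightarrow> 'a set multiset) \<Rightarrow> bool" where
  "is_factorization V E k r F \<longleftrightarrow>
     (\<Sum>i\<in>{1..k}. F i) = E \<and> (\<forall>i\<in>{1..k}. is_factor V E (r i) (F i))"

definition factorable :: "'a set \<Rightarrow> 'a set multiset \<Rightarrow> nat \<Rightarrow> (nat \<Rightarrow> nat) \<Rightarrow> bool" where
  "factorable V E k r \<longleftrightarrow> (\<exists>F. is_factorization V E k r F)"

text \<open>Any two vertices are joined by a walk whose consecutive vertices lie in a common edge.\<close>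

definition hconnected :: "'a set \<Rightarrow> 'a set multiset \<Rightarrow> bool" where
  "hconnected V E \<longleftrightarrow>
     (\<forall>u\<in>V. \<forall>v\<in>V. (u, v) \<in> {(x, y). \<exists>e. e \<in># E \<and> x \<in> e \<and> y \<in> e}\<^sup>*)"

definition edges_of_size :: "'a set multiset \<Rightarrow> nat \<Rightarrow> nat" where
  "edges_of_size E s = size {#e \<in># E. card e = s#}"

definition degree_condition ::
  "nat \<Rightarrow> nat \<Rightarrow> nat \<Rightarrow> (nat \<Rightarrow> nat) \<Rightarrow> (nat \<Rightarrow> nat) \<Rightarrow> (nat \<Rightarrow> nat) \<Rightarrow> bool" where
  "degree_condition n m k lam h r \<longleftrightarrow>
     (\<Sum>i\<in>{1..m}. lam i * ((n - 1) choose (h i - 1))) = (\<Sum>i\<in>{1..k}. r i)"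

text \<open>The first conjunct is the matrix equation \<open>A H = n R\<close>, written entrywise.\<close>

definition matrix_condition ::
  "nat \<Rightarrow> nat \<Rightarrow> nat \<Rightarrow> (nat \<Rightarrow> nat) \<Rightarrow> (nat \<Rightarrow> nat) \<Rightarrow> (nat \<Rightarrow> nat) \<Rightarrow>
   (nat \<Rightarrow> nat \<Rightarrow> nat) \<Rightarrow> bool" where
  "matrix_condition n m k lam h r A \<longleftrightarrow>
     (\<forall>i\<in>{1..k}. (\<Sum>j\<in>{1..m}. A i j * h j) = n * r i) \<and>
     (\<forall>j\<in>{1..m}. (\<Sum>i\<in>{1..k}. A i j) = lam j * (n choose h j))"

end

theory Submission
  imports Defs
begin

text \<open>
  Following Baranyai and Bahmanian, start from a single amalgamated vertex of weight \<open>n\<close>: every edge of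
  size \<open>h\<close> meets it in \<open>h\<close> hinges, and \<open>A i j\<close> of the edges of size \<open>h j\<close> get colour \<open>i\<close>. The true vertices
  are split off one at a time. When the weight is \<open>N\<close>, moving the fraction \<open>1 / N\<close> of all hinges to the new
  vertex would preserve every count, and the rounding of this fractional choice to an integral one
  is an integral flow: the prescribed counts form two laminar families, one given by the
  colours and the components within them, the other by the traces of the edges on the vertices
  already split off.

  A colour class stays connected because the number of components left by deleting the amalgamated
  vertex stays at most \<open>N (r - 1) + 1\<close> and each of them keeps a hinge. For \<open>N = n\<close> this is the
  condition of the theorem, since each edge is then a component, and for \<open>N = 0\<close> it leaves one component.
\<close>

section \<open>Rounding of circulations\<close>

text \<open>Arcs are abstract elements with a tail map \<open>t\<close> and a head map
  \<open>h\<close>. This allows loops and parallel arcs, and contracting nodes becomes composition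
  of both maps with a map of nodes.\<close>

definition net_outflow :: "'e set \<Rightarrow> ('e \<Rightarrow> 'v) \<Rightarrow> ('e \<Rightarrow> 'v) \<Rightarrow> ('e \<Rightarrow> int) \<Rightarrow> 'v \<Rightarrow> int" where
  "net_outflow E t h z v = (\<Sum>e\<in>E. (if t e = v then z e else 0) - (if h e = v then z e else 0))"

definition throughput :: "'e set \<Rightarrow> ('e \<Rightarrow> 'v) \<Rightarrow> ('e \<Rightarrow> 'v) \<Rightarrow> ('e \<Rightarrow> int) \<Rightarrow> 'v \<Rightarrow> int" where
  "throughput E t h z v = (\<Sum>e\<in>E. (if t e = v then \<bar>z e\<bar> else 0) + (if h e = v then \<bar>z e\<bar> else 0))"

definition circulation :: "'e set \<Rightarrow> ('e \<Rightarrow> 'v) \<Rightarrow> ('e \<Rightarrow> 'v) \<Rightarrow> ('e \<Rightarrow> int) \<Rightarrow> bool" where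
  "circulation E t h z \<longleftrightarrow> (\<forall>v. net_outflow E t h z v = 0)"

lemma abs_net_outflow_le: "\<bar>net_outflow E t h z v\<bar> \<le> throughput E t h z v"
  unfolding net_outflow_def throughput_def
  by (rule order_trans[OF sum_abs]) (auto intro: sum_mono)

lemma throughput_nonneg: "0 \<le> throughput E t h z v"
  unfolding throughput_def by (auto intro: sum_nonneg)

lemma net_outflow_0: "net_outflow E t h (\<lambda>_. 0) v = 0"
  unfolding net_outflow_def by (auto intro: sum.neutral)

lemma throughput_0: "throughput E t h (\<lambda>_. 0) v = 0"
  unfolding throughput_def by (auto intro: sum.neutral)

lemma net_outflow_upd:
  assumes "finite E" "a \<in> E"
  shows "net_outflow E t h (z(a := b)) v = net_outflow (E - {a}) t h z v
           + (if t a = v then b else 0) - (if h a = v then b else 0)"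
proof -
  have "net_outflow E t h (z(a := b)) v = (if t a = v then b else 0) - (if h a = v then b else 0)
          + net_outflow (E - {a}) t h (z(a := b)) v"
    unfolding net_outflow_def by (subst sum.remove[OF assms]) simp
  also have "net_outflow (E - {a}) t h (z(a := b)) v = net_outflow (E - {a}) t h z v"
    unfolding net_outflow_def by (rule sum.cong) auto
  finally show ?thesis by linarith
qed

lemma throughput_upd:
  assumes "finite E" "a \<in> E"
  shows "throughput E t h (z(a := b)) v = throughput (E - {a}) t h z v
           + (if t a = v then \<bar>b\<bar> else 0) + (if h a = v then \<bar>b\<bar> else 0)"
proof -
  have "throughput E t h (z(a := b)) v = (if t a = v then \<bar>b\<bar> else 0) + (if h a = v then \<bar>b\<bar> else 0)
          + throughput (E - {a}) t h (z(a := b)) v"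
    unfolding throughput_def by (subst sum.remove[OF assms]) simp
  also have "throughput (E - {a}) t h (z(a := b)) v = throughput (E - {a}) t h z v"
    unfolding throughput_def by (rule sum.cong) auto
  finally show ?thesis by linarith
qed

lemma net_outflow_contract:
  assumes "u \<noteq> v"
  defines "c \<equiv> \<lambda>x. if x = v then u else x"
  shows "w \<noteq> u \<Longrightarrow> w \<noteq> v \<Longrightarrow> net_outflow E (c \<circ> t) (c \<circ> h) z w = net_outflow E t h z w"
    and "net_outflow E (c \<circ> t) (c \<circ> h) z u = net_outflow E t h z u + net_outflow E t h z v"
  using assms unfolding net_outflow_def by (auto simp flip: sum.distrib intro!: sum.cong)

lemma throughput_contract:
  assumes "u \<noteq> v"
  defines "c \<equiv> \<lambda>x. if x = v then u else x"
  shows "w \<noteq> u \<Longrightarrow> w \<noteq> v \<Longrightarrow> throughput E (c \<circ> t) (c \<circ> h) z w = throughput E t h z w"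
    and "throughput E (c \<circ> t) (c \<circ> h) z u = throughput E t h z u + throughput E t h z v"
    and "throughput E (c \<circ> t) (c \<circ> h) z v = 0"
  using assms unfolding throughput_def by (auto simp flip: sum.distrib intro!: sum.cong sum.neutral)

text \<open>The degree of a node is its throughput under the constant flow 1, so that loops count twice.
  The proof contracts an arc; the bound on the throughput, which says that the circulation passes
  every node at most once, makes it extend to the contracted arc with a value of modulus at most 1.\<close>

lemma unit_circulation_exists:
  assumes "finite E" "E \<noteq> {}" "\<And>v. throughput E t h (\<lambda>_. 1) v \<noteq> 1"
  shows "\<exists>z. circulation E t h z \<and> (\<exists>e\<in>E. z e \<noteq> 0) \<and> (\<forall>e\<in>E. \<bar>z e\<bar> \<le> 1) \<and>
             (\<forall>v. throughput E t h z v \<le> 2)"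
  using assms
proof (induction E arbitrary: t h rule: finite_psubset_induct)
  case (psubset E)
  show ?case
  proof (cases "\<exists>a\<in>E. t a = h a")
    case True
    then obtain a where a: "a \<in> E" "t a = h a" by blast
    \<comment> \<open>A unit flow on a loop is conserved everywhere. Tail and head both count, so it
      just meets the throughput bound 2.\<close>
    define z where "z = (\<lambda>_. 0::int)(a := 1)"
    have "net_outflow E t h z v = 0" "throughput E t h z v \<le> 2" for v
      unfolding z_def net_outflow_upd[OF psubset.hyps a(1)] throughput_upd[OF psubset.hyps a(1)]
      using a by (auto simp: net_outflow_0 throughput_0)
    moreover have "z a \<noteq> 0" "\<forall>e\<in>E. \<bar>z e\<bar> \<le> 1" by (auto simp: z_def)
    ultimately show ?thesis using a(1) unfolding circulation_def by blast
  next
    case False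
    from psubset.prems obtain a where a: "a \<in> E" by blast
    define u v where "u = t a" and "v = h a"
    have uv: "u \<noteq> v" using False a by (auto simp: u_def v_def)
    define c where "c = (\<lambda>x. if x = v then u else x)"
    let ?E = "E - {a}" and ?t = "c \<circ> t" and ?h = "c \<circ> h"
    note contract = net_outflow_contract[OF uv, folded c_def] throughput_contract[OF uv, folded c_def]
    have deg: "throughput E t h (\<lambda>_. 1) w = throughput ?E t h (\<lambda>_. 1) w
        + (if u = w then 1 else 0) + (if v = w then 1 else 0)" for w
      using throughput_upd[OF psubset.hyps a, of t h "\<lambda>_. 1" 1 w] by (simp add: u_def v_def fun_upd_idem)
    \<comment> \<open>Each end of \<open>a\<close> has degree at least 2 in \<open>E\<close>, hence
      at least 1 without \<open>a\<close>. The contracted node therefore has degree at least 2, as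
      the induction needs, and \<open>v\<close> becomes isolated.\<close>
    have pos: "throughput ?E t h (\<lambda>_. 1) u \<ge> 1" "throughput ?E t h (\<lambda>_. 1) v \<ge> 1"
      using deg[of u] deg[of v] uv psubset.prems(2)[of u] psubset.prems(2)[of v]
        throughput_nonneg[of ?E t h "\<lambda>_. 1" u] throughput_nonneg[of ?E t h "\<lambda>_. 1" v] by auto
    have ne: "?E \<noteq> {}"
    proof
      assume "?E = {}"
      then have "throughput ?E t h (\<lambda>_. 1) u = 0" unfolding throughput_def by (metis sum.empty)
      with pos(1) show False by simp
    qed
    have "throughput ?E ?t ?h (\<lambda>_. 1) w \<noteq> 1" for w
    proof (cases "w = u \<or> w = v")
      case True
      then show ?thesis using contract(4,5)[of ?E t h "\<lambda>_. 1"] pos by auto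
    next
      case False
      then show ?thesis using contract(3)[of w ?E t h "\<lambda>_. 1"] deg[of w] psubset.prems(2)[of w] by auto
    qed
    from psubset.IH[of ?E ?t ?h, OF _ ne this] a obtain z where
      z: "circulation ?E ?t ?h z" "\<exists>e\<in>?E. z e \<noteq> 0" "\<forall>e\<in>?E. \<bar>z e\<bar> \<le> 1"
         "\<forall>v. throughput ?E ?t ?h z v \<le> 2" by blast
    \<comment> \<open>Conservation at \<open>u\<close> forces this value on \<open>a\<close>.
      Conservation at \<open>v\<close> follows, since the net outflows at \<open>u\<close> and
      \<open>v\<close> cancel in the contracted network.\<close>
    define b where "b = - net_outflow ?E t h z u"
    have sum0: "net_outflow ?E t h z u + net_outflow ?E t h z v = 0"
      using z(1) contract(2)[of ?E t h z] unfolding circulation_def by metis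
    have sum2: "throughput ?E t h z u + throughput ?E t h z v \<le> 2"
      using z(4) contract(4)[of ?E t h z] by metis
    have b1: "\<bar>b\<bar> \<le> throughput ?E t h z u" "\<bar>b\<bar> \<le> throughput ?E t h z v"
      using abs_net_outflow_le[of ?E t h z u] abs_net_outflow_le[of ?E t h z v] sum0
      by (auto simp: b_def)
    \<comment> \<open>\<open>\<bar>b\<bar>\<close> is at most the throughput at the opposite end, so
      adding it at one end stays within the joint bound 2 of the contracted node.\<close>
    have b2: "\<bar>b\<bar> + throughput ?E t h z u \<le> 2" "\<bar>b\<bar> + throughput ?E t h z v \<le> 2"
      using b1 sum2 by linarith+
    have "net_outflow E t h (z(a := b)) w = 0" for w
    proof (cases "w = u \<or> w = v")
      case True
      then show ?thesis using uv sum0 unfolding net_outflow_upd[OF psubset.hyps a]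
        by (auto simp: u_def[symmetric] v_def[symmetric] b_def)
    next
      case False
      then show ?thesis using contract(1)[of w ?E t h z] z(1) 
        unfolding net_outflow_upd[OF psubset.hyps a] circulation_def
        by (auto simp: u_def[symmetric] v_def[symmetric])
    qed
    moreover have "throughput E t h (z(a := b)) w \<le> 2" for w
    proof (cases "w = u \<or> w = v")
      case True
      then show ?thesis using uv b2 unfolding throughput_upd[OF psubset.hyps a]
        by (auto simp: u_def[symmetric] v_def[symmetric])
    next
      case False
      then show ?thesis using contract(3)[of w ?E t h z] z(4)
        unfolding throughput_upd[OF psubset.hyps a]
        by (auto simp: u_def[symmetric] v_def[symmetric]) metis
    qed
    moreover have "\<forall>e\<in>E. \<bar>(z(a := b)) e\<bar> \<le> 1" using z(3) b1 sum2 by auto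
    moreover have "\<exists>e\<in>E. (z(a := b)) e \<noteq> 0" using z(2) by auto
    ultimately show ?thesis unfolding circulation_def by blast
  qed
qed

lemma net_outflow_lincomb:
  "net_outflow E t h (\<lambda>e. y e + s * z e) v = net_outflow E t h y v + s * net_outflow E t h z v"
  unfolding net_outflow_def sum_distrib_left sum.distrib[symmetric]
  by (rule sum.cong) (auto simp: algebra_simps)

lemma net_outflow_mult: "net_outflow E t h (\<lambda>e. N * y e) v = N * net_outflow E t h y v"
  unfolding net_outflow_def sum_distrib_left by (rule sum.cong) (auto simp: algebra_simps)

text \<open>Among the circulations with values in the intervals between consecutive multiples of \<open>N\<close>, one
  with the largest sum of squares has only multiples of \<open>N\<close> as values: otherwise it could be moved
  both ways along a unit circulation on the arcs with other values.\<close>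

lemma circulation_rounding:
  fixes f :: "'e \<Rightarrow> int"
  assumes fin: "finite E" and N: "N > 0" and f: "circulation E t h f"
  shows "\<exists>g. circulation E t h g \<and> (\<forall>e\<in>E. \<bar>N * g e - f e\<bar> < N)"
proof -
  \<comment> \<open>The nearest multiples of \<open>N\<close> below and above \<open>f e\<close>;
    they coincide if \<open>N\<close> divides \<open>f e\<close>, which pins the value on such
    arcs.\<close>
  define L U where "L = (\<lambda>e. N * (f e div N))" and "U = (\<lambda>e. - (N * ((- f e) div N)))"
  have LU: "L e \<le> f e" "f e \<le> U e" "f e < L e + N" "U e < f e + N" "N dvd L e" "N dvd U e" for e
  proof -
    have "f e = N * (f e div N) + f e mod N" "- f e = N * (- f e div N) + (- f e) mod N" by simp_all
    moreover have "0 \<le> f e mod N" "f e mod N < N" "0 \<le> (- f e) mod N" "(- f e) mod N < N"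
      using N by simp_all
    ultimately show "L e \<le> f e" "f e \<le> U e" "f e < L e + N" "U e < f e + N" "N dvd L e" "N dvd U e"
      unfolding L_def U_def by linarith+ auto
  qed
  define feasible where
    "feasible = (\<lambda>y. circulation E t h y \<and> (\<forall>e\<in>E. L e \<le> y e \<and> y e \<le> U e))"
  define \<Phi> :: "('e \<Rightarrow> int) \<Rightarrow> int" where "\<Phi> = (\<lambda>y. \<Sum>e\<in>E. (y e)\<^sup>2)"
  have \<Phi>nonneg: "0 \<le> \<Phi> y" for y unfolding \<Phi>_def by (simp add: sum_nonneg)
  have "\<Phi> y \<le> (\<Sum>e\<in>E. (\<bar>L e\<bar> + \<bar>U e\<bar>)\<^sup>2)" if "feasible y" for y
    unfolding \<Phi>_def
  proof (rule sum_mono)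
    fix e assume "e \<in> E"
    then have "\<bar>y e\<bar> \<le> \<bar>L e\<bar> + \<bar>U e\<bar>" using that unfolding feasible_def by force
    then show "(y e)\<^sup>2 \<le> (\<bar>L e\<bar> + \<bar>U e\<bar>)\<^sup>2" by (simp add: abs_le_square_iff[symmetric])
  qed
  then have bound: "nat (\<Phi> y) < Suc (nat (\<Sum>e\<in>E. (\<bar>L e\<bar> + \<bar>U e\<bar>)\<^sup>2))" if "feasible y" for y
    using that by (meson le_imp_less_Suc nat_mono)
  have "feasible f" using f LU unfolding feasible_def by auto
  from ex_has_greatest_nat[of feasible f "\<lambda>y. nat (\<Phi> y)", OF this] bound
  obtain y where y: "feasible y" and max: "\<And>y'. feasible y' \<Longrightarrow> nat (\<Phi> y') \<le> nat (\<Phi> y)"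
    by (metis less_imp_le)
  define F where "F = {e\<in>E. \<not> N dvd y e}"
  have "F = {}"
  proof (rule ccontr)
    assume ne: "F \<noteq> {}"
    have finF: "finite F" and FE: "F \<subseteq> E" using fin by (auto simp: F_def)
    \<comment> \<open>If exactly one arc end of \<open>F\<close> lay at \<open>v\<close>,
      conservation at \<open>v\<close> would make the value on that arc, up to sign, a sum of
      multiples of \<open>N\<close>.\<close>
    have "throughput F t h (\<lambda>_. 1) v \<noteq> 1" for v
    proof
      assume 1: "throughput F t h (\<lambda>_. 1) v = 1"
      define \<delta> where "\<delta> = (\<lambda>e. (if t e = v then 1 else 0) + (if h e = v then 1 else 0) :: int)"
      have s1: "(\<Sum>e\<in>F. \<delta> e) = 1" using 1 unfolding throughput_def \<delta>_def by simp
      then obtain a where a: "a \<in> F" "\<delta> a \<noteq> 0" by (metis sum.neutral zero_neq_one)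
      have nn: "\<And>e. \<delta> e \<ge> 0" by (auto simp: \<delta>_def)
      have rest: "\<delta> a + (\<Sum>e\<in>F-{a}. \<delta> e) = 1" using s1 by (simp add: sum.remove[OF finF a(1)])
      have r0: "(\<Sum>e\<in>F-{a}. \<delta> e) \<ge> 0" using nn by (simp add: sum_nonneg)
      have "\<delta> a \<ge> 1" using nn[of a] a(2) by linarith
      then have a1: "\<delta> a = 1" and "(\<Sum>e\<in>F-{a}. \<delta> e) = 0" using rest r0 by linarith+
      then have zero: "\<delta> e = 0" if "e \<in> F - {a}" for e
        using that nn finF by (metis finite_Diff sum_nonneg_eq_0_iff)
      define w where "w = (\<lambda>e. (if t e = v then y e else 0) - (if h e = v then y e else 0))"
      have "(\<Sum>e\<in>E. w e) = 0" using y unfolding feasible_def circulation_def net_outflow_def w_def by auto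
      then have wa: "w a + (\<Sum>e\<in>E-{a}. w e) = 0" using a(1) FE fin sum.remove[of E a w] by auto
      have "N dvd w e" if "e \<in> E - {a}" for e
      proof (cases "e \<in> F")
        case True
        then show ?thesis using zero[of e] that unfolding w_def \<delta>_def by (auto split: if_splits)
      next
        case False
        then show ?thesis using that unfolding w_def F_def by auto
      qed
      then have "N dvd (\<Sum>e\<in>E-{a}. w e)" by (rule dvd_sum)
      then have "N dvd w a" using wa by (metis add.commute dvd_0_right dvd_add_right_iff)
      moreover have "w a = y a \<or> w a = - y a" using a1 unfolding w_def \<delta>_def by (auto split: if_splits)
      ultimately have "N dvd y a" by auto
      then show False using a(1) by (simp add: F_def)
    qed
    from unit_circulation_exists[OF finF ne this] obtain z where
      z: "circulation F t h z" "\<exists>e\<in>F. z e \<noteq> 0" "\<forall>e\<in>F. \<bar>z e\<bar> \<le> 1" by blast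
    define z' where "z' = (\<lambda>e. if e \<in> F then z e else 0)"
    have "net_outflow E t h z' v = net_outflow F t h z v" for v
      unfolding net_outflow_def z'_def by (rule sum.mono_neutral_cong_right) (use fin FE in auto)
    then have z'circ: "net_outflow E t h z' v = 0" for v using z(1) unfolding circulation_def by simp
    \<comment> \<open>On \<open>F\<close> the value lies strictly between the bounds, which are
      multiples of \<open>N\<close>, so a step of size at most 1 in either direction respects
      them.\<close>
    have feas: "feasible (\<lambda>e. y e + s * z' e)" if "s = 1 \<or> s = -1" for s
    proof -
      have "L e \<le> y e + s * z' e \<and> y e + s * z' e \<le> U e" if "e \<in> E" for e
      proof (cases "e \<in> F")
        case True
        then have "L e \<noteq> y e" "U e \<noteq> y e" using LU(5,6)[of e] unfolding F_def by auto
        moreover have "L e \<le> y e" "y e \<le> U e" using y that unfolding feasible_def by auto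
        moreover have "\<bar>s * z' e\<bar> \<le> 1" using z(3) True \<open>s = 1 \<or> s = -1\<close> unfolding z'_def by auto
        ultimately show ?thesis by linarith
      next
        case False
        then show ?thesis using y that unfolding feasible_def z'_def by auto
      qed
      then show ?thesis using y z'circ unfolding feasible_def circulation_def
        by (auto simp: net_outflow_lincomb)
    qed
    \<comment> \<open>The parallelogram identity: the two moved circulations together exceed twice
      the sum of squares of \<open>y\<close>, so one of them contradicts maximality.\<close>
    have "\<Phi> (\<lambda>e. y e + 1 * z' e) + \<Phi> (\<lambda>e. y e + (-1) * z' e) = 2 * \<Phi> y + 2 * \<Phi> z'"
      unfolding \<Phi>_def sum_distrib_left sum.distrib[symmetric]
      by (rule sum.cong) (auto simp: power2_eq_square algebra_simps)
    moreover have "\<Phi> z' > 0"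
    proof -
      obtain e where "e \<in> F" "z e \<noteq> 0" using z(2) by blast
      then show ?thesis unfolding \<Phi>_def using FE fin
        by (intro sum_pos2[of _ e]) (auto simp: z'_def)
    qed
    moreover have le: "\<Phi> (\<lambda>e. y e + s * z' e) \<le> \<Phi> y" if "s = 1 \<or> s = -1" for s
      using max[OF feas[OF that]] \<Phi>nonneg[of y] by (simp add: nat_le_iff)
    ultimately show False using le[OF disjI1[OF refl]] le[OF disjI2[OF refl]] by linarith
  qed
  then have div: "y e = N * (y e div N)" if "e \<in> E" for e using that by (auto simp: F_def)
  define g where "g = (\<lambda>e. y e div N)"
  have "net_outflow E t h g v = 0" for v
  proof -
    have "net_outflow E t h y v = net_outflow E t h (\<lambda>e. N * g e) v"
      unfolding net_outflow_def by (rule sum.cong) (use div in \<open>auto simp: g_def\<close>)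
    then show ?thesis using y N unfolding feasible_def circulation_def by (simp add: net_outflow_mult)
  qed
  moreover have "\<bar>N * g e - f e\<bar> < N" if "e \<in> E" for e
  proof -
    have "L e \<le> y e" "y e \<le> U e" using y that unfolding feasible_def by auto
    then show ?thesis using div[OF that] LU[of e] unfolding g_def by linarith
  qed
  ultimately show ?thesis unfolding circulation_def by blast
qed

section \<open>Simultaneous rounding over two laminar families\<close>

datatype ('x, 'k, 'c, 't) arc = Item 'x | Key 'k | Colour 'c | Type 't
datatype ('k, 'c, 't) node = AtKey 'k | AtColour 'c | AtType 't | Hub

text \<open>The flow runs from the hub through the colours, the keys and the items to the types and back;
  conservation makes the flow through a key, colour or type the sum over the items in its fibre.\<close>

lemma laminar_rounding:
  fixes f :: "'x \<Rightarrow> int" and key :: "'x \<Rightarrow> 'k" and col :: "'k \<Rightarrow> 'c" and type :: "'x \<Rightarrow> 't"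
  assumes fin: "finite X" and N: "N > 0"
  shows "\<exists>g. (\<forall>x\<in>X. \<bar>N * g x - f x\<bar> < N) \<and>
    (\<forall>\<kappa>. \<bar>N * (\<Sum>x | x \<in> X \<and> key x = \<kappa>. g x) - (\<Sum>x | x \<in> X \<and> key x = \<kappa>. f x)\<bar> < N) \<and>
    (\<forall>c. \<bar>N * (\<Sum>x | x \<in> X \<and> col (key x) = c. g x) - (\<Sum>x | x \<in> X \<and> col (key x) = c. f x)\<bar> < N) \<and>
    (\<forall>\<tau>. \<bar>N * (\<Sum>x | x \<in> X \<and> type x = \<tau>. g x) - (\<Sum>x | x \<in> X \<and> type x = \<tau>. f x)\<bar> < N)"
proof -
  define tail :: "('x, 'k, 'c, 't) arc \<Rightarrow> ('k, 'c, 't) node" where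
    "tail = case_arc (\<lambda>x. AtKey (key x)) (\<lambda>\<kappa>. AtColour (col \<kappa>)) (\<lambda>c. Hub) AtType"
  define head :: "('x, 'k, 'c, 't) arc \<Rightarrow> ('k, 'c, 't) node" where
    "head = case_arc (\<lambda>x. AtType (type x)) AtKey AtColour (\<lambda>\<tau>. Hub)"
  \<comment> \<open>Only keys, colours and types that occur get arcs, which keeps the network
    finite. All other fibres are empty, and their bounds hold because \<open>N > 0\<close>.\<close>
  define E :: "('x, 'k, 'c, 't) arc set" where
    "E = Item ` X \<union> Key ` key ` X \<union> Colour ` col ` key ` X \<union> Type ` type ` X"
  have finE: "finite E" using fin by (simp add: E_def)
  have sumE: "(\<Sum>e\<in>E. w e) = (\<Sum>x\<in>X. w (Item x)) + (\<Sum>\<kappa>\<in>key`X. w (Key \<kappa>))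
      + (\<Sum>c\<in>col`key`X. w (Colour c)) + (\<Sum>\<tau>\<in>type`X. w (Type \<tau>))" for w :: "_ \<Rightarrow> int"
  proof -
    have "(\<Sum>e\<in>E. w e) = (\<Sum>e\<in>Item ` X. w e) + (\<Sum>e\<in>Key ` key ` X. w e)
        + (\<Sum>e\<in>Colour ` col ` key ` X. w e) + (\<Sum>e\<in>Type ` type ` X. w e)"
      unfolding E_def using fin by (subst sum.union_disjoint; auto)+
    then show ?thesis by (simp add: sum.reindex inj_on_def)
  qed
  have at_key: "net_outflow E tail head G (AtKey \<kappa>) =
      (\<Sum>x | x \<in> X \<and> key x = \<kappa>. G (Item x)) - (if \<kappa> \<in> key ` X then G (Key \<kappa>) else 0)" for G \<kappa>
    using fin unfolding net_outflow_def sumE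
    by (simp add: tail_def head_def sum_subtractf sum.inter_filter sum_negf)
  have at_colour: "net_outflow E tail head G (AtColour c) =
      (\<Sum>\<kappa> | \<kappa> \<in> key ` X \<and> col \<kappa> = c. G (Key \<kappa>)) - (if c \<in> col ` key ` X then G (Colour c) else 0)" for G c
    using fin unfolding net_outflow_def sumE
    by (simp add: tail_def head_def sum_subtractf sum.inter_filter sum_negf)
  have at_type: "net_outflow E tail head G (AtType \<tau>) =
      (if \<tau> \<in> type ` X then G (Type \<tau>) else 0) - (\<Sum>x | x \<in> X \<and> type x = \<tau>. G (Item x))" for G \<tau>
    using fin unfolding net_outflow_def sumE
    by (simp add: tail_def head_def sum_subtractf sum.inter_filter sum_negf)
  have at_hub: "net_outflow E tail head G Hub =
      (\<Sum>c\<in>col`key`X. G (Colour c)) - (\<Sum>\<tau>\<in>type`X. G (Type \<tau>))" for G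
    using fin unfolding net_outflow_def sumE
    by (simp add: tail_def head_def sum_subtractf sum.inter_filter sum_negf)
  have group_key: "(\<Sum>\<kappa> | \<kappa> \<in> key ` X \<and> col \<kappa> = c. \<Sum>x | x \<in> X \<and> key x = \<kappa>. w x)
      = (\<Sum>x | x \<in> X \<and> col (key x) = c. w x)" for w :: "'x \<Rightarrow> int" and c
  proof -
    have "(\<Sum>\<kappa> | \<kappa> \<in> key ` X \<and> col \<kappa> = c. \<Sum>x | x \<in> X \<and> key x = \<kappa>. w x)
        = (\<Sum>\<kappa> | \<kappa> \<in> key ` X \<and> col \<kappa> = c. \<Sum>x | x \<in> {x \<in> X. col (key x) = c} \<and> key x = \<kappa>. w x)"
      by (intro sum.cong) auto
    also have "\<dots> = (\<Sum>x | x \<in> X \<and> col (key x) = c. w x)"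
      using fin by (intro sum.group) auto
    finally show ?thesis .
  qed
  \<comment> \<open>Every arc that is not an item carries the total of \<open>f\<close> over its
    fibre. Conservation holds by construction, and rounding the arc rounds the fibre sum.\<close>
  define F where "F = case_arc f (\<lambda>\<kappa>. \<Sum>x | x \<in> X \<and> key x = \<kappa>. f x)
    (\<lambda>c. \<Sum>x | x \<in> X \<and> col (key x) = c. f x) (\<lambda>\<tau>. \<Sum>x | x \<in> X \<and> type x = \<tau>. f x)"
  have empty: "{x \<in> X. p x = y} = {}" if "y \<notin> p ` X" for p :: "'x \<Rightarrow> 'y" and y using that by auto
  have "net_outflow E tail head F v = 0" for v
  proof (cases v)
    case (AtKey \<kappa>)
    show ?thesis unfolding AtKey at_key
      by (cases "\<kappa> \<in> key ` X") (simp_all add: F_def empty)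
  next
    case (AtColour c)
    show ?thesis unfolding AtColour at_colour
      by (cases "c \<in> col ` key ` X") (auto simp: F_def group_key intro!: sum.neutral)
  next
    case (AtType \<tau>)
    show ?thesis unfolding AtType at_type
      by (cases "\<tau> \<in> type ` X") (simp_all add: F_def empty)
  next
    case Hub
    have "(\<Sum>c\<in>col ` key ` X. F (Colour c)) = sum f X"
      unfolding F_def arc.case using fin by (intro sum.group) auto
    moreover have "(\<Sum>\<tau>\<in>type ` X. F (Type \<tau>)) = sum f X"
      unfolding F_def arc.case using fin by (intro sum.group) auto
    ultimately show ?thesis unfolding Hub at_hub by simp
  qed
  then have "circulation E tail head F" by (simp add: circulation_def)
  from circulation_rounding[OF finE N this] obtain G where
    G: "\<And>v. net_outflow E tail head G v = 0" and near: "\<And>e. e \<in> E \<Longrightarrow> \<bar>N * G e - F e\<bar> < N"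
    unfolding circulation_def by blast
  have key_sum: "(\<Sum>x | x \<in> X \<and> key x = \<kappa>. G (Item x)) = G (Key \<kappa>)" if "\<kappa> \<in> key ` X" for \<kappa>
    using G[of "AtKey \<kappa>"] that unfolding at_key by simp
  have type_sum: "(\<Sum>x | x \<in> X \<and> type x = \<tau>. G (Item x)) = G (Type \<tau>)" if "\<tau> \<in> type ` X" for \<tau>
    using G[of "AtType \<tau>"] that unfolding at_type by simp
  have col_sum: "(\<Sum>x | x \<in> X \<and> col (key x) = c. G (Item x)) = G (Colour c)" if "c \<in> col ` key ` X" for c
  proof -
    have "(\<Sum>x | x \<in> X \<and> col (key x) = c. G (Item x)) = (\<Sum>\<kappa> | \<kappa> \<in> key ` X \<and> col \<kappa> = c. G (Key \<kappa>))"
      unfolding group_key[symmetric] by (intro sum.cong) (auto intro: key_sum)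
    then show ?thesis using G[of "AtColour c"] that unfolding at_colour by simp
  qed
  have "\<bar>N * G (Item x) - f x\<bar> < N" if "x \<in> X" for x
    using near[of "Item x"] that by (simp add: E_def F_def)
  moreover have "\<bar>N * (\<Sum>x | x \<in> X \<and> key x = \<kappa>. G (Item x)) - (\<Sum>x | x \<in> X \<and> key x = \<kappa>. f x)\<bar> < N" for \<kappa>
  proof (cases "\<kappa> \<in> key ` X")
    case True
    then show ?thesis using near[of "Key \<kappa>"] unfolding key_sum[OF True] by (simp add: E_def F_def)
  qed (simp add: empty N)
  moreover have "\<bar>N * (\<Sum>x | x \<in> X \<and> type x = \<tau>. G (Item x)) - (\<Sum>x | x \<in> X \<and> type x = \<tau>. f x)\<bar> < N" for \<tau>
  proof (cases "\<tau> \<in> type ` X")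
    case True
    then show ?thesis using near[of "Type \<tau>"] unfolding type_sum[OF True] by (simp add: E_def F_def)
  qed (simp add: empty N)
  moreover have "\<bar>N * (\<Sum>x | x \<in> X \<and> col (key x) = c. G (Item x)) - (\<Sum>x | x \<in> X \<and> col (key x) = c. f x)\<bar> < N" for c
  proof (cases "c \<in> col ` key ` X")
    case True
    then show ?thesis using near[of "Colour c"] unfolding col_sum[OF True] by (simp add: E_def F_def)
  next
    case False
    then have none: "{x \<in> X. col (key x) = c} = {}" by auto
    show ?thesis unfolding none using N by simp
  qed
  ultimately show ?thesis by (intro exI[of _ "\<lambda>x. G (Item x)"]) blast
qed

section \<open>Detachment of a vertex\<close>

text \<open>One colour class at the detachment of a vertex from an amalgamated vertex of weight \<open>N\<close>: edge
  \<open>y\<close> meets the amalgamated vertex in \<open>t y\<close> hinges, \<open>lab y\<close> names the component of \<open>y\<close> in the rest of the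
  class, and the edges in \<open>M\<close> give one hinge each to the new vertex, which unites the components of
  these edges.\<close>

lemma merge_components:
  fixes t :: "'x \<Rightarrow> nat" and lab :: "'x \<Rightarrow> 'l" and N r :: nat and Y M :: "'x set"
  defines "d \<equiv> \<lambda>l. \<Sum>y | y \<in> Y \<and> lab y = l. t y"
  assumes fin: "finite Y" and MY: "M \<subseteq> Y" and N: "N \<ge> 1" and r: "r \<ge> 1"
    and total: "sum t Y = N * r" and cardM: "card M = r"
    and pos: "\<And>y. y \<in> Y \<Longrightarrow> d (lab y) \<ge> 1"
    and edge: "\<And>y. y \<in> Y \<Longrightarrow> N * of_bool (y \<in> M) < t y + N \<and> t y < N * of_bool (y \<in> M) + N"
    and comp: "\<And>l. d l \<noteq> 1 \<Longrightarrow>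
      N * card {y \<in> M. lab y = l} < d l + N \<and> d l < N * card {y \<in> M. lab y = l} + N"
    and unit: "N * card {y \<in> M. d (lab y) = 1} < (\<Sum>y | y \<in> Y \<and> d (lab y) = 1. t y) + N"
    and few: "card (lab ` Y) \<le> N * (r - 1) + 1"
  shows "card (lab ` Y - lab ` M) \<le> (N - 1) * (r - 1)"
    and "N \<ge> 2 \<Longrightarrow> \<exists>y\<in>Y. lab y \<in> lab ` M \<and> of_bool (y \<in> M) < t y"
proof -
  define b :: "'x \<Rightarrow> nat" where "b = (\<lambda>y. of_bool (y \<in> M))"
  define mv where "mv = (\<lambda>l. card {y \<in> M. lab y = l})"
  have finM: "finite M" using fin MY by (rule finite_subset[rotated])
  \<comment> \<open>An edge without hinges cannot be in \<open>M\<close>: the first half of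
    \<open>edge\<close> would read \<open>N < N\<close>.\<close>
  have bt: "b y \<le> t y" if "y \<in> Y" for y
    using edge[OF that] unfolding b_def by (cases "y \<in> M") auto
  have mv_b: "mv l = (\<Sum>y | y \<in> Y \<and> lab y = l. b y)" for l
    using fin MY unfolding mv_def b_def by (auto simp: of_bool_def sum.If_cases intro!: arg_cong[of _ _ card])
  have mv_d: "mv l \<le> d l" for l unfolding mv_b d_def by (rule sum_mono) (auto intro: bt)
  have sum_d: "(\<Sum>l\<in>lab ` Y. d l) = N * r"
    unfolding d_def total[symmetric] using fin by (intro sum.group) auto
  have sum_mv: "(\<Sum>l\<in>lab ` M. mv l) = r"
    unfolding mv_def using finM cardM sum.group[OF finM, of "lab ` M" lab "\<lambda>_. 1::nat"] by auto
  have fL: "finite (lab ` Y)" "finite (lab ` M)" and LM: "lab ` M \<subseteq> lab ` Y"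
    using fin finM MY by auto
  have split: "card (lab ` Y - lab ` M) + card (lab ` M) = card (lab ` Y)"
    using card_mono[OF fL(1) LM] by (simp add: card_Diff_subset[OF fL(2) LM])
  have d_pos: "d l \<ge> 1" if "l \<in> lab ` Y" for l using pos that by auto
  have hinge_left: "\<exists>y\<in>Y. lab y \<in> lab ` M \<and> of_bool (y \<in> M) < t y" if "l \<in> lab ` M" "mv l < d l" for l
  proof (rule ccontr)
    assume "\<not> ?thesis"
    then have "d l \<le> mv l" unfolding mv_b d_def b_def using that(1) by (intro sum_mono) force
    then show False using that by simp
  qed
  have "card (lab ` Y - lab ` M) \<le> (N - 1) * (r - 1) \<and>
    (N \<ge> 2 \<longrightarrow> (\<exists>y\<in>Y. lab y \<in> lab ` M \<and> of_bool (y \<in> M) < t y))"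
  proof (cases "N = 1")
    case True
    \<comment> \<open>With weight 1 every hinge moves, so \<open>M\<close> meets every
      component.\<close>
    have tb: "t y = b y" if "y \<in> Y" for y using edge[OF that] True by (simp add: b_def)
    have "l \<in> lab ` M" if "l \<in> lab ` Y" for l
    proof (rule ccontr)
      assume "l \<notin> lab ` M"
      then have "d l = 0" unfolding d_def by (auto simp: tb b_def intro!: sum.neutral)
      then show False using d_pos[OF that] by simp
    qed
    then have none: "lab ` Y - lab ` M = {}" by auto
    show ?thesis unfolding none using True by simp
  next
    case False
    with N have N2: "N \<ge> 2" by simp
    show ?thesis
    proof (cases "\<exists>l\<in>lab ` Y. d l \<ge> N")
      case True
      then obtain l where l: "l \<in> lab ` Y" "d l \<ge> N" by blast
      have nu: "N * mv l < d l + N" "d l < N * mv l + N"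
        using comp[of l] l N2 unfolding mv_def by auto
      then obtain q where q: "mv l = Suc q" using l by (cases "mv l") auto
      then have "{y \<in> M. lab y = l} \<noteq> {}" unfolding mv_def by (metis card.empty nat.distinct(1))
      then have lM: "l \<in> lab ` M" by auto
      \<comment> \<open>If one hinge moves, this is \<open>d l \<ge> N\<close>; if more move, the
        rounding bound \<open>N * (mv l - 1) < d l\<close> is strong enough.\<close>
      have rest: "mv l + (N - 1) \<le> d l"
      proof (cases q)
        case 0
        then show ?thesis using q l N by simp
      next
        case (Suc p)
        obtain N' where N': "N = Suc N'" using N by (cases N) auto
        then show ?thesis using nu q Suc by (simp add: algebra_simps)
      qed
      \<comment> \<open>Hinges are counted instead of components: those met by \<open>M\<close> hold
        at least \<open>r + (N - 1)\<close> of the \<open>N * r\<close> hinges. At most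
        \<open>(N - 1) * (r - 1)\<close> are left for the other components, each of which has
        one.\<close>
      have "(\<Sum>l'\<in>lab ` M. mv l') + (N - 1) \<le> (\<Sum>l'\<in>lab ` M. d l')"
        using rest sum_mono[of "lab ` M - {l}" mv d] mv_d
        by (simp add: sum.remove[OF fL(2) lM])
      moreover have "card (lab ` Y - lab ` M) \<le> (\<Sum>l'\<in>lab ` Y - lab ` M. d l')"
        using sum_mono[of "lab ` Y - lab ` M" "\<lambda>_. 1" d] d_pos by simp
      moreover have "(\<Sum>l'\<in>lab ` Y - lab ` M. d l') + (\<Sum>l'\<in>lab ` M. d l') = N * r"
        unfolding sum_d[symmetric] by (rule sum.subset_diff[OF LM fL(1), symmetric])
      moreover obtain N' r' where "N = Suc N'" "r = Suc r'" using N r by (cases N; cases r) auto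
      ultimately have "card (lab ` Y - lab ` M) \<le> (N - 1) * (r - 1)"
        using sum_mv by (simp add: algebra_simps)
      moreover have "mv l < d l" using rest N2 by simp
      ultimately show ?thesis using hinge_left[OF lM] by simp
    next
      case False
      \<comment> \<open>All components are small now, so each loses at most one hinge and
        \<open>M\<close> meets at least \<open>r\<close> of them. Subtracting \<open>r\<close> from
        the bound \<open>few\<close> gives the claim.\<close>
      have mv1: "mv l \<le> 1" if "l \<in> lab ` Y" for l
      proof (cases "d l = 1")
        case True
        then show ?thesis using mv_d[of l] by simp
      next
        case nu: False
        have "N * mv l < d l + N" using comp[OF nu] by (simp add: mv_def)
        also have "\<dots> < N * 2" using False that by auto
        finally show ?thesis by simp
      qed
      have "r \<le> (\<Sum>l\<in>lab ` M. 1)" unfolding sum_mv[symmetric] by (rule sum_mono) (use mv1 LM in auto)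
      then have "r \<le> card (lab ` M)" by simp
      moreover obtain N' r' where Nr: "N = Suc N'" "r = Suc r'" using N r by (cases N; cases r) auto
      ultimately have 1: "card (lab ` Y - lab ` M) \<le> (N - 1) * (r - 1)"
        using split few by (simp add: algebra_simps)
      \<comment> \<open>Components with a single hinge are used up when \<open>M\<close> meets them.
        Not all components are of this kind, as \<open>N * r\<close> exceeds the bound
        \<open>few\<close>; then \<open>unit\<close> puts fewer than \<open>r\<close> edges of
        \<open>M\<close> into them, and a remaining edge of \<open>M\<close> lies in a component
        that keeps a hinge.\<close>
      define L1 where "L1 = {l \<in> lab ` Y. d l = 1}"
      have "L1 \<noteq> lab ` Y"
      proof
        assume "L1 = lab ` Y"
        then have "(\<Sum>l\<in>lab ` Y. d l) = (\<Sum>l\<in>lab ` Y. 1)" by (intro sum.cong) (auto simp: L1_def)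
        then have "N * r \<le> N * (r - 1) + 1" using sum_d few by simp
        then show False using N2 Nr by (simp add: algebra_simps)
      qed
      then have "L1 \<subset> lab ` Y" by (auto simp: L1_def)
      then have "card L1 < card (lab ` Y)" using fL(1) by (rule psubset_card_mono[rotated])
      then have L1: "card L1 \<le> N * (r - 1)" using few by simp
      have "(\<Sum>y | y \<in> Y \<and> d (lab y) = 1. t y) = (\<Sum>l\<in>L1. \<Sum>y | y \<in> {y \<in> Y. d (lab y) = 1} \<and> lab y = l. t y)"
        using fin fL(1) by (intro sum.group[symmetric]) (auto simp: L1_def)
      also have "\<dots> = (\<Sum>l\<in>L1. d l)"
        unfolding d_def by (intro sum.cong) (auto simp: L1_def d_def)
      also have "\<dots> = card L1" by (simp add: L1_def)
      finally have "N * card {y \<in> M. d (lab y) = 1} < N * (r - 1) + N" using unit L1 by simp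
      also have "\<dots> = N * r" using Nr by simp
      finally have "card {y \<in> M. d (lab y) = 1} < card M" using cardM by simp
      then have "\<exists>y\<in>M. d (lab y) \<noteq> 1" by (metis (mono_tags, lifting) Collect_mem_eq Collect_cong less_irrefl)
      then obtain y where y: "y \<in> M" "d (lab y) \<noteq> 1" by blast
      then have "mv (lab y) < d (lab y)" using mv1[of "lab y"] d_pos[of "lab y"] MY by fastforce
      then show ?thesis using 1 hinge_left[of "lab y"] y by simp
    qed
  qed
  then show "card (lab ` Y - lab ` M) \<le> (N - 1) * (r - 1)"
    and "N \<ge> 2 \<Longrightarrow> \<exists>y\<in>Y. lab y \<in> lab ` M \<and> of_bool (y \<in> M) < t y" by blast+
qed

section \<open>Invariants of a detachment and their preservation\<close>

text \<open>The graph whose points are the edges. Sharing the amalgamated vertex does not count, so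
  an edge with all its hinges there is linked to no other edge.\<close>

definition edge_links :: "'x set \<Rightarrow> ('x \<Rightarrow> 'v set) \<Rightarrow> ('x \<times> 'x) set" where
  "edge_links Y S = {(x, y). x \<in> Y \<and> y \<in> Y \<and> S x \<inter> S y \<noteq> {}}"

lemma edge_links_mono: "(\<And>x. x \<in> Y \<Longrightarrow> S x \<subseteq> S' x) \<Longrightarrow> edge_links Y S \<subseteq> edge_links Y S'"
  unfolding edge_links_def by blast

text \<open>A detachment in progress: the vertices in \<open>U\<close> have been split off the amalgamated vertex, which
  still has weight \<open>N\<close>. Edge \<open>x\<close> will have size \<open>sz x\<close>, its trace on \<open>U\<close> is \<open>S x\<close>, and the missing
  \<open>sz x - card (S x)\<close> incidences are its hinges at the amalgamated vertex. The labels \<open>lab\<close> refine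
  the components of a colour class \<open>Y\<close> without the amalgamated vertex.\<close>

definition traces_ok ::
  "'x set \<Rightarrow> ('x \<Rightarrow> nat) \<Rightarrow> (nat \<Rightarrow> nat) \<Rightarrow> nat \<Rightarrow> 'v set \<Rightarrow> ('x \<Rightarrow> 'v set) \<Rightarrow> bool" where
  "traces_ok X sz mu N U S \<longleftrightarrow> (\<forall>x\<in>X. S x \<subseteq> U \<and> card (S x) \<le> sz x) \<and>
     (\<forall>T s. T \<subseteq> U \<longrightarrow> card {x \<in> X. S x = T \<and> sz x = s} =
        (if card T \<le> s then mu s * (N choose (s - card T)) else 0))"

definition degrees_ok ::
  "'x set \<Rightarrow> ('x \<Rightarrow> nat) \<Rightarrow> nat \<Rightarrow> nat \<Rightarrow> 'v set \<Rightarrow> ('x \<Rightarrow> 'v set) \<Rightarrow> bool" where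
  "degrees_ok Y sz r N U S \<longleftrightarrow> (\<forall>v\<in>U. card {x \<in> Y. v \<in> S x} = r) \<and>
     (\<Sum>x\<in>Y. sz x - card (S x)) = N * r"

text \<open>Equal labels imply linked edges, so the number of labels bounds the number of components
  from above. The guard \<open>N \<ge> 1\<close> is there because no hinges remain at weight
  0.\<close>

definition components_ok ::
  "'x set \<Rightarrow> ('x \<Rightarrow> nat) \<Rightarrow> nat \<Rightarrow> nat \<Rightarrow> ('x \<Rightarrow> 'v set) \<Rightarrow> ('x \<Rightarrow> 'l) \<Rightarrow> bool" where
  "components_ok Y sz r N S lab \<longleftrightarrow> card (lab ` Y) \<le> N * (r - 1) + 1 \<and>
     (N \<ge> 1 \<longrightarrow> (\<forall>x\<in>Y. \<exists>y\<in>Y. lab y = lab x \<and> card (S y) < sz y)) \<and>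
     (\<forall>x\<in>Y. \<forall>y\<in>Y. lab x = lab y \<longrightarrow> (x, y) \<in> (edge_links Y S)\<^sup>*)"

text \<open>Rounding leaves a count exact where the fractional count is already an integer.\<close>

lemma multiple_near_eq:
  fixes N a b :: int
  assumes "\<bar>N * a - N * b\<bar> < N"
  shows "a = b"
proof (rule ccontr)
  assume "a \<noteq> b"
  then have "1 \<le> \<bar>a - b\<bar>" by simp
  moreover have "0 < N" using assms by linarith
  ultimately have "N * 1 \<le> N * \<bar>a - b\<bar>" by (intro mult_left_mono) auto
  then show False using assms \<open>0 < N\<close> by (simp add: abs_mult flip: right_diff_distrib)
qed

text \<open>Absorption identity: the hinges of all edges of one type are a multiple of the weight,
  so their share for the new vertex is integral. The case \<open>k = 0\<close> stands apart because
  \<open>k - 1\<close> is truncated.\<close>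

lemma times_choose_Suc: "k * (Suc N choose k) = Suc N * (if k = 0 then 0 else N choose (k - 1))"
  using times_binomial_minus1_eq[of k "Suc N"] by simp

text \<open>The edges in \<open>M\<close> move one hinge each to the new vertex.\<close>

lemma traces_detach:
  assumes fin: "finite X" "finite U" and u: "u \<notin> U" and tr: "traces_ok X sz mu (Suc N) U S"
    and MX: "M \<subseteq> X" and M_hinge: "\<And>x. x \<in> M \<Longrightarrow> card (S x) < sz x"
    and M_types: "\<And>T s. T \<subseteq> U \<Longrightarrow> card T \<le> s \<Longrightarrow> card {x \<in> M. S x = T \<and> sz x = s}
      = mu s * (if s = card T then 0 else N choose (s - card T - 1))"
  shows "traces_ok X sz mu N (insert u U) (\<lambda>x. if x \<in> M then insert u (S x) else S x)"
proof -
  let ?S = "\<lambda>x. if x \<in> M then insert u (S x) else S x"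
  have SU: "S x \<subseteq> U" "card (S x) \<le> sz x" "finite (S x)" "u \<notin> S x" if "x \<in> X" for x
    using tr that fin(2) u unfolding traces_ok_def by (auto intro: finite_subset)
  have cnt: "card {x \<in> X. S x = T \<and> sz x = s} = (if card T \<le> s then mu s * (Suc N choose (s - card T)) else 0)"
    if "T \<subseteq> U" for T s using tr that unfolding traces_ok_def by blast
  have finM: "finite M" using fin(1) MX by (rule finite_subset[rotated])
  have "?S x \<subseteq> insert u U \<and> card (?S x) \<le> sz x" if "x \<in> X" for x
    using SU[OF that] M_hinge[of x] by auto
  moreover have "card {x \<in> X. ?S x = T \<and> sz x = s} =
      (if card T \<le> s then mu s * (N choose (s - card T)) else 0)" if T: "T \<subseteq> insert u U" for T s
  proof (cases "u \<in> T")
    case False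
    then have TU: "T \<subseteq> U" using T by auto
    have "{x \<in> X. ?S x = T \<and> sz x = s} = {x \<in> X. S x = T \<and> sz x = s} - {x \<in> M. S x = T \<and> sz x = s}"
      using False MX by auto
    then have eq: "card {x \<in> X. ?S x = T \<and> sz x = s}
        = card {x \<in> X. S x = T \<and> sz x = s} - card {x \<in> M. S x = T \<and> sz x = s}"
      using finM MX by (simp add: card_Diff_subset subset_iff)
    show ?thesis
    proof (cases "card T \<le> s")
      case True
      \<comment> \<open>Pascal's rule: of the completions of \<open>T\<close> by vertices still
        amalgamated, those through \<open>u\<close> have moved away.\<close>
      have "(Suc N choose k) - (if k = 0 then 0 else N choose (k - 1)) = N choose k" for k
        by (cases k) auto
      from this[of "s - card T"] show ?thesis
        unfolding eq cnt[OF TU] M_types[OF TU True] using True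
        by (auto simp flip: diff_mult_distrib2 split: if_splits)
    qed (simp add: eq cnt[OF TU])
  next
    case True
    define T0 where "T0 = T - {u}"
    have T0: "T0 \<subseteq> U" "T = insert u T0" "u \<notin> T0" using T True by (auto simp: T0_def)
    have fT0: "finite T0" using T0(1) fin(2) finite_subset by blast
    have eq: "{x \<in> X. ?S x = T \<and> sz x = s} = {x \<in> M. S x = T0 \<and> sz x = s}"
      using MX T0 SU(4) by (auto simp: insert_eq_iff split: if_splits)
    have cT: "card T = Suc (card T0)" using T0 fT0 by simp
    have none: "{x \<in> M. S x = T0 \<and> sz x = s} = {}" if "\<not> card T0 \<le> s"
      using M_hinge that by force
    show ?thesis unfolding eq cT using M_types[OF T0(1), of s]
      by (cases "card T0 \<le> s") (auto simp: none)
  qed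
  ultimately show ?thesis unfolding traces_ok_def by blast
qed

lemma degrees_detach:
  assumes fin: "finite Y" "finite U" and u: "u \<notin> U" and SU: "\<And>x. x \<in> Y \<Longrightarrow> S x \<subseteq> U"
    and dg: "degrees_ok Y sz r (Suc N) U S"
    and MY: "M \<subseteq> Y" and M_hinge: "\<And>x. x \<in> M \<Longrightarrow> card (S x) < sz x" and cardM: "card M = r"
  shows "degrees_ok Y sz r N (insert u U) (\<lambda>x. if x \<in> M then insert u (S x) else S x)"
proof -
  let ?S = "\<lambda>x. if x \<in> M then insert u (S x) else S x"
  have fS: "finite (S x)" "u \<notin> S x" if "x \<in> Y" for x using SU[OF that] fin(2) u finite_subset by auto
  have "card {x \<in> Y. v \<in> ?S x} = r" if "v \<in> insert u U" for v
  proof (cases "v = u")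
    case True
    then have "{x \<in> Y. v \<in> ?S x} = M" using MY fS(2) by auto
    then show ?thesis using cardM by simp
  next
    case False
    then have "{x \<in> Y. v \<in> ?S x} = {x \<in> Y. v \<in> S x}" by auto
    then show ?thesis using dg that False unfolding degrees_ok_def by auto
  qed
  moreover have "(\<Sum>x\<in>Y. sz x - card (?S x)) = N * r"
  proof -
    have "(\<Sum>x\<in>Y. sz x - card (?S x)) + card M = (\<Sum>x\<in>Y. (sz x - card (?S x)) + (if x \<in> M then 1 else 0))"
      using fin(1) MY by (simp add: sum.distrib sum.If_cases Int_absorb1)
    also have "\<dots> = (\<Sum>x\<in>Y. sz x - card (S x))"
    proof (rule sum.cong)
      fix x assume "x \<in> Y"
      then show "sz x - card (?S x) + (if x \<in> M then 1 else 0) = sz x - card (S x)"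
        using fS[of x] M_hinge[of x] by auto
    qed simp
    also have "\<dots> = Suc N * r" using dg by (simp add: degrees_ok_def)
    finally show ?thesis using cardM by simp
  qed
  ultimately show ?thesis unfolding degrees_ok_def by blast
qed

text \<open>All components met by \<open>M\<close> unite at \<open>u\<close> and take the label of
  one edge \<open>p\<close> of \<open>M\<close>, while the others keep theirs. The count is
  \<open>merge_components\<close> with the hinges of an edge as \<open>t\<close>.\<close>

lemma components_detach:
  fixes lab :: "'x \<Rightarrow> 'l" and Y M :: "'x set" and sz :: "'x \<Rightarrow> nat" and S :: "'x \<Rightarrow> 'v set"
  defines "d \<equiv> \<lambda>l. \<Sum>y | y \<in> Y \<and> lab y = l. sz y - card (S y)"
  assumes fin: "finite Y" "finite U" and u: "u \<notin> U" and SU: "\<And>x. x \<in> Y \<Longrightarrow> S x \<subseteq> U"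
    and dg: "degrees_ok Y sz r (Suc N) U S" and co: "components_ok Y sz r (Suc N) S lab"
    and r: "r \<ge> 1" and MY: "M \<subseteq> Y" and cardM: "card M = r"
    and edge: "\<And>y. y \<in> Y \<Longrightarrow> Suc N * of_bool (y \<in> M) < (sz y - card (S y)) + Suc N \<and>
      sz y - card (S y) < Suc N * of_bool (y \<in> M) + Suc N"
    and comp: "\<And>l. d l \<noteq> 1 \<Longrightarrow> Suc N * card {y \<in> M. lab y = l} < d l + Suc N \<and>
      d l < Suc N * card {y \<in> M. lab y = l} + Suc N"
    and unit: "Suc N * card {y \<in> M. d (lab y) = 1}
      < (\<Sum>y | y \<in> Y \<and> d (lab y) = 1. sz y - card (S y)) + Suc N"
    and p: "p \<in> M"
  shows "components_ok Y sz r N (\<lambda>x. if x \<in> M then insert u (S x) else S x)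
    (\<lambda>x. if lab x \<in> lab ` M then lab p else lab x)"
proof -
  let ?S = "\<lambda>x. if x \<in> M then insert u (S x) else S x"
  let ?lab = "\<lambda>x. if lab x \<in> lab ` M then lab p else lab x"
  have fS: "finite (S x)" "u \<notin> S x" if "x \<in> Y" for x using SU[OF that] fin(2) u finite_subset by auto
  have total: "(\<Sum>x\<in>Y. sz x - card (S x)) = Suc N * r" using dg by (simp add: degrees_ok_def)
  have few: "card (lab ` Y) \<le> Suc N * (r - 1) + 1"
    and open_comp: "\<And>x. x \<in> Y \<Longrightarrow> \<exists>y\<in>Y. lab y = lab x \<and> card (S y) < sz y"
    and linked: "\<And>x y. x \<in> Y \<Longrightarrow> y \<in> Y \<Longrightarrow> lab x = lab y \<Longrightarrow> (x, y) \<in> (edge_links Y S)\<^sup>*"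
    using co unfolding components_ok_def by auto
  have pos: "d (lab x) \<ge> 1" if x: "x \<in> Y" for x
  proof -
    obtain y where y: "y \<in> Y" "lab y = lab x" "card (S y) < sz y" using open_comp[OF x] by blast
    have "sz y - card (S y) \<le> d (lab x)"
      unfolding d_def using y fin(1) by (intro member_le_sum) auto
    then show ?thesis using y by simp
  qed
  note merge = merge_components[of Y M "Suc N" r "\<lambda>y. sz y - card (S y)" lab,
      OF fin(1) MY _ r total cardM pos[unfolded d_def] edge comp[unfolded d_def] unit[unfolded d_def] few]
  have "?lab ` Y \<subseteq> insert (lab p) (lab ` Y - lab ` M)" by auto
  then have "card (?lab ` Y) \<le> card (insert (lab p) (lab ` Y - lab ` M))"
    using fin(1) by (intro card_mono) auto
  also have "\<dots> \<le> card (lab ` Y - lab ` M) + 1" by (simp add: card_insert_le_m1 card_insert_if)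
  also have "\<dots> \<le> N * (r - 1) + 1" using merge(1) by simp
  finally have 1: "card (?lab ` Y) \<le> N * (r - 1) + 1" .
  have 2: "\<exists>y\<in>Y. ?lab y = ?lab x \<and> card (?S y) < sz y" if "N \<ge> 1" "x \<in> Y" for x
  proof (cases "lab x \<in> lab ` M")
    case True
    obtain y where "y \<in> Y" "lab y \<in> lab ` M" "of_bool (y \<in> M) < sz y - card (S y)"
      using merge(2) \<open>N \<ge> 1\<close> by auto
    then show ?thesis using True fS[of y] by (intro bexI[of _ y]) auto
  next
    case False
    obtain y where y: "y \<in> Y" "lab y = lab x" "card (S y) < sz y" using open_comp \<open>x \<in> Y\<close> by blast
    then have "y \<notin> M" using False by (metis imageI)
    then show ?thesis using y False by (intro bexI[of _ y]) auto
  qed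
  have mono: "(edge_links Y S)\<^sup>* \<subseteq> (edge_links Y ?S)\<^sup>*"
    by (intro rtrancl_mono edge_links_mono) auto
  have 3: "(x, y) \<in> (edge_links Y ?S)\<^sup>*" if xy: "x \<in> Y" "y \<in> Y" "?lab x = ?lab y" for x y
  proof (cases "lab x \<in> lab ` M")
    case True
    then have "lab y \<in> lab ` M" using xy(3) p by (metis imageI)
    \<comment> \<open>The link from \<open>x\<close> to \<open>y\<close> passes through edges
      \<open>x'\<close> and \<open>y'\<close> of \<open>M\<close>, which now share
      \<open>u\<close>.\<close>
    then obtain x' y' where x'y': "x' \<in> M" "y' \<in> M" "lab x = lab x'" "lab y = lab y'"
      using True by auto
    have "(x, x') \<in> (edge_links Y ?S)\<^sup>*" "(y', y) \<in> (edge_links Y ?S)\<^sup>*"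
      using linked[of x x'] linked[of y' y] mono xy x'y' MY by auto
    moreover have "(x', y') \<in> edge_links Y ?S"
      using x'y' MY by (auto simp: edge_links_def)
    ultimately show ?thesis by (meson rtrancl.rtrancl_into_rtrancl rtrancl_trans)
  next
    case False
    then have "lab x = lab y" using xy(3) p by (metis imageI)
    then show ?thesis using linked[OF xy(1,2)] mono by auto
  qed
  show ?thesis unfolding components_ok_def using 1 2 3 by blast
qed

lemma degrees_ok_cong:
  "(\<And>x. x \<in> Y \<Longrightarrow> S x = S' x) \<Longrightarrow> degrees_ok Y sz r N U S \<longleftrightarrow> degrees_ok Y sz r N U S'"
  unfolding degrees_ok_def by (simp cong: conj_cong)

lemma components_ok_cong:
  assumes "\<And>x. x \<in> Y \<Longrightarrow> S x = S' x" "\<And>x. x \<in> Y \<Longrightarrow> lab x = lab' x"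
  shows "components_ok Y sz r N S lab \<longleftrightarrow> components_ok Y sz r N S' lab'"
proof -
  have "edge_links Y S = edge_links Y S'" using assms(1) unfolding edge_links_def by auto
  moreover have "lab ` Y = lab' ` Y" using assms(2) by auto
  ultimately show ?thesis unfolding components_ok_def using assms by simp
qed

text \<open>One rounding serves all requirements: edge \<open>x\<close> should ideally give
  \<open>t x / Suc N\<close> hinges to \<open>u\<close>, and the sums by component, colour and type
  are rounded along with it. \<open>C\<close> collects the colours to be kept connected.\<close>

lemma detach_vertex:
  fixes col :: "'x \<Rightarrow> 'c" and lab :: "'x \<Rightarrow> 'l"
  assumes fin: "finite X" "finite U" and u: "u \<notin> U" and tr: "traces_ok X sz mu (Suc N) U S"
    and dg: "\<And>i. i \<in> K \<Longrightarrow> degrees_ok {x \<in> X. col x = i} sz (r i) (Suc N) U S"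
    and co: "\<And>i. i \<in> C \<Longrightarrow> components_ok {x \<in> X. col x = i} sz (r i) (Suc N) S lab"
    and CK: "C \<subseteq> K" and r: "\<And>i. i \<in> K \<Longrightarrow> r i \<ge> 1"
  shows "\<exists>S' (lab' :: 'x \<Rightarrow> 'l). traces_ok X sz mu N (insert u U) S' \<and>
    (\<forall>i\<in>K. degrees_ok {x \<in> X. col x = i} sz (r i) N (insert u U) S') \<and>
    (\<forall>i\<in>C. components_ok {x \<in> X. col x = i} sz (r i) N S' lab')"
proof -
  let ?N = "Suc N"
  define t where "t = (\<lambda>x. sz x - card (S x))"
  define d where "d = (\<lambda>i l. \<Sum>y | y \<in> {x \<in> X. col x = i} \<and> lab y = l. t y)"
  \<comment> \<open>The single-hinge components of a colour share one key: each can lose at most one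
    hinge anyway, but \<open>merge_components\<close> needs a bound on their total.\<close>
  define key where "key = (\<lambda>x. (col x, if d (col x) (lab x) = 1 then None else Some (lab x)))"
  obtain g where
    g_edge: "\<And>x. x \<in> X \<Longrightarrow> \<bar>int ?N * g x - int (t x)\<bar> < int ?N" and
    g_key: "\<And>\<kappa>. \<bar>int ?N * (\<Sum>x | x \<in> X \<and> key x = \<kappa>. g x) - (\<Sum>x | x \<in> X \<and> key x = \<kappa>. int (t x))\<bar> < int ?N" and
    g_col: "\<And>i. \<bar>int ?N * (\<Sum>x | x \<in> X \<and> fst (key x) = i. g x) - (\<Sum>x | x \<in> X \<and> fst (key x) = i. int (t x))\<bar> < int ?N" and
    g_type: "\<And>\<tau>. \<bar>int ?N * (\<Sum>x | x \<in> X \<and> (S x, sz x) = \<tau>. g x) - (\<Sum>x | x \<in> X \<and> (S x, sz x) = \<tau>. int (t x))\<bar> < int ?N"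
    using laminar_rounding[OF fin(1), of "int ?N" "\<lambda>x. int (t x)" key fst "\<lambda>x. (S x, sz x)",
        OF iffD2[OF of_nat_0_less_iff zero_less_Suc]] by blast
  have SU: "S x \<subseteq> U" "card (S x) \<le> sz x" if "x \<in> X" for x
    using tr that unfolding traces_ok_def by auto
  have cnt: "card {x \<in> X. S x = T \<and> sz x = s} = (if card T \<le> s then mu s * (?N choose (s - card T)) else 0)"
    if "T \<subseteq> U" for T s using tr that unfolding traces_ok_def by blast
  \<comment> \<open>The type of \<open>x\<close> occurs, so its binomial coefficient is positive.
    This restricts \<open>g\<close> to 0 and 1: no edge gives two hinges to
    \<open>u\<close>.\<close>
  have t_le: "t x \<le> ?N" if x: "x \<in> X" for x
  proof -
    have "card {y \<in> X. S y = S x \<and> sz y = sz x} \<noteq> 0"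
      by (subst card_eq_0_iff) (use fin(1) x in auto)
    then have "(?N choose (sz x - card (S x))) \<noteq> 0"
      unfolding cnt[OF SU(1)[OF x]] by (auto split: if_splits)
    then show ?thesis unfolding t_def by (metis binomial_eq_0 not_le)
  qed
  define M where "M = {x \<in> X. g x = 1}"
  have MX: "M \<subseteq> X" by (auto simp: M_def)
  have finM: "finite M" using fin(1) by (simp add: M_def)
  have g01: "g x = of_bool (x \<in> M)" if x: "x \<in> X" for x
  proof -
    have "P < n * 2 \<and> n * (-1) < P" if "\<bar>P - int q\<bar> < n" "int q \<le> n" for P n q
      using that by linarith
    from this[OF g_edge[OF x]] t_le[OF x]
    have "int ?N * g x < int ?N * 2" "int ?N * (-1) < int ?N * g x" by (simp_all only: of_nat_le_iff)
    then have "g x < 2" "-1 < g x" by (simp_all only: mult_less_cancel_left_pos of_nat_0_less_iff zero_less_Suc)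
    then have "g x = 0 \<or> g x = 1" by linarith
    then show ?thesis using x by (auto simp: M_def)
  qed
  have sum_g: "(\<Sum>x | x \<in> X \<and> P x. g x) = int (card {x \<in> M. P x})" for P
  proof -
    have "(\<Sum>x | x \<in> X \<and> P x. g x) = (\<Sum>x | x \<in> X \<and> P x. if x \<in> M then 1 else 0)"
      by (rule sum.cong) (auto simp: g01)
    also have "\<dots> = int (card ({x \<in> X. P x} \<inter> M))" using fin(1) by (simp add: sum.If_cases Int_def)
    also have "{x \<in> X. P x} \<inter> M = {x \<in> M. P x}" using MX by auto
    finally show ?thesis .
  qed
  have edge: "?N * of_bool (x \<in> M) < t x + ?N \<and> t x < ?N * of_bool (x \<in> M) + ?N" if x: "x \<in> X" for x
    using g_edge[OF x] unfolding g01[OF x] by (cases "x \<in> M") auto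
  have M_hinge: "card (S x) < sz x" if "x \<in> M" for x
    using edge[of x] that MX by (auto simp: t_def)
  have near: "?N * card {x \<in> M. P x} < (\<Sum>x | x \<in> X \<and> P x. t x) + ?N \<and>
      (\<Sum>x | x \<in> X \<and> P x. t x) < ?N * card {x \<in> M. P x} + ?N"
    if "\<bar>int ?N * (\<Sum>x | x \<in> X \<and> P x. g x) - (\<Sum>x | x \<in> X \<and> P x. int (t x))\<bar> < int ?N" for P
  proof -
    have "\<bar>int (?N * card {x \<in> M. P x}) - int (\<Sum>x | x \<in> X \<and> P x. t x)\<bar> < int ?N"
      using that unfolding sum_g by (simp only: of_nat_mult of_nat_sum)
    moreover have "a < b + n \<and> b < a + n" if "\<bar>int a - int b\<bar> < int n" for a b n
      using that by linarith
    ultimately show ?thesis by blast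
  qed
  have exact: "card {x \<in> M. P x} = c"
    if "\<bar>int ?N * (\<Sum>x | x \<in> X \<and> P x. g x) - (\<Sum>x | x \<in> X \<and> P x. int (t x))\<bar> < int ?N"
      "(\<Sum>x | x \<in> X \<and> P x. t x) = ?N * c" for P c
  proof -
    have "\<bar>int ?N * int (card {x \<in> M. P x}) - int ?N * int c\<bar> < int ?N"
      using that unfolding sum_g by (metis of_nat_mult of_nat_sum)
    from multiple_near_eq[OF this] show ?thesis by simp
  qed
  have M_types: "card {x \<in> M. S x = T \<and> sz x = s} = mu s * (if s = card T then 0 else N choose (s - card T - 1))"
    if T: "T \<subseteq> U" "card T \<le> s" for T s
  proof -
    have "(\<Sum>x | x \<in> X \<and> (S x = T \<and> sz x = s). t x) = (\<Sum>x | x \<in> X \<and> (S x = T \<and> sz x = s). s - card T)"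
      by (rule sum.cong) (auto simp: t_def)
    also have "\<dots> = mu s * ((s - card T) * (?N choose (s - card T)))" using T by (simp add: cnt)
    also have "\<dots> = ?N * (mu s * (if s = card T then 0 else N choose (s - card T - 1)))"
      unfolding times_choose_Suc using T(2) by (auto simp: algebra_simps)
    finally show ?thesis using g_type[of "(T, s)"] by (intro exact) simp_all
  qed
  have cardM: "card {x \<in> M. col x = i} = r i" if i: "i \<in> K" for i
  proof -
    have "(\<Sum>x | x \<in> X \<and> col x = i. t x) = ?N * r i" using dg[OF i] by (simp add: degrees_ok_def t_def)
    then show ?thesis using g_col[of i] by (intro exact) (simp_all add: key_def)
  qed
  define S' where "S' = (\<lambda>x. if x \<in> M then insert u (S x) else S x)"
  \<comment> \<open>The representative depends on the colour alone, so one labelling serves all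
    colours.\<close>
  define lab' where "lab' = (\<lambda>x. if lab x \<in> lab ` {y \<in> M. col y = col x}
    then lab (SOME p. p \<in> M \<and> col p = col x) else lab x)"
  have "traces_ok X sz mu N (insert u U) S'"
    unfolding S'_def by (rule traces_detach[OF fin u tr MX M_hinge M_types])
  moreover have "degrees_ok {x \<in> X. col x = i} sz (r i) N (insert u U) S'" if i: "i \<in> K" for i
  proof -
    have "degrees_ok {x \<in> X. col x = i} sz (r i) N (insert u U)
        (\<lambda>x. if x \<in> {x \<in> M. col x = i} then insert u (S x) else S x)"
      by (rule degrees_detach[OF _ fin(2) u _ dg[OF i] _ _ cardM[OF i]]) (use fin SU MX M_hinge in auto)
    then show ?thesis by (subst degrees_ok_cong) (auto simp: S'_def)
  qed
  moreover have "components_ok {x \<in> X. col x = i} sz (r i) N S' lab'" if i: "i \<in> C" for i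
  proof -
    have iK: "i \<in> K" using i CK by auto
    let ?Y = "{x \<in> X. col x = i}" and ?M = "{x \<in> M. col x = i}" and ?p = "SOME p. p \<in> M \<and> col p = i"
    have "?M \<noteq> {}" using cardM[OF iK] r[OF iK] by (metis card.empty not_one_le_zero)
    then have "\<exists>p. p \<in> M \<and> col p = i" by auto
    then have p: "?p \<in> ?M" using someI_ex[of "\<lambda>p. p \<in> M \<and> col p = i"] by auto
    have conv: "{y \<in> Z. col y = i \<and> P y} = {y. y \<in> {x \<in> Z. col x = i} \<and> P y}" for Z P by auto
    have comp: "?N * card {y \<in> ?M. lab y = l} < d i l + ?N \<and> d i l < ?N * card {y \<in> ?M. lab y = l} + ?N"
      if "d i l \<noteq> 1" for l
    proof -
      have "key x = (i, Some l) \<longleftrightarrow> col x = i \<and> lab x = l" for x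
        using that by (auto simp: key_def)
      then show ?thesis using near[OF g_key[of "(i, Some l)"]] by (simp only: conv d_def)
    qed
    have unit: "?N * card {y \<in> ?M. d i (lab y) = 1} < (\<Sum>y | y \<in> ?Y \<and> d i (lab y) = 1. t y) + ?N"
    proof -
      have "key x = (i, None) \<longleftrightarrow> col x = i \<and> d i (lab x) = 1" for x by (auto simp: key_def)
      then show ?thesis using near[OF g_key[of "(i, None)"]] by (simp only: conv)
    qed
    have "components_ok ?Y sz (r i) N (\<lambda>x. if x \<in> ?M then insert u (S x) else S x)
        (\<lambda>x. if lab x \<in> lab ` ?M then lab ?p else lab x)"
    proof (rule components_detach[OF _ fin(2) u _ dg[OF iK] co[OF i] r[OF iK] _ cardM[OF iK] _ _ _ p])
      show "Suc N * of_bool (y \<in> ?M) < (sz y - card (S y)) + Suc N \<and>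
          sz y - card (S y) < Suc N * of_bool (y \<in> ?M) + Suc N" if "y \<in> ?Y" for y
        using edge[of y] that by (simp add: t_def)
    qed (use fin SU MX comp unit in \<open>auto simp: d_def t_def\<close>)
    then show ?thesis by (subst components_ok_cong) (auto simp: S'_def lab'_def)
  qed
  ultimately show ?thesis by blast
qed

text \<open>Induction over the set \<open>U\<close> of vertices already split off, with weight
  \<open>card V - card U\<close>. At the start all traces are empty and every edge is its own
  component, so the edges themselves serve as labels.\<close>

lemma detachment_exists:
  fixes col :: "'x \<Rightarrow> 'c" and sz :: "'x \<Rightarrow> nat" and V :: "'v set"
  assumes fin: "finite X" "finite V"
    and types: "\<And>s. card {x \<in> X. sz x = s} = mu s * (card V choose s)"
    and sizes: "\<And>i. i \<in> K \<Longrightarrow> (\<Sum>x | x \<in> X \<and> col x = i. sz x) = card V * r i"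
    and pos: "\<And>x. x \<in> X \<Longrightarrow> sz x \<ge> 1"
    and few: "\<And>i. i \<in> C \<Longrightarrow> card {x \<in> X. col x = i} \<le> card V * (r i - 1) + 1"
    and CK: "C \<subseteq> K" and r: "\<And>i. i \<in> K \<Longrightarrow> r i \<ge> 1"
  shows "\<exists>S (lab :: 'x \<Rightarrow> 'x). traces_ok X sz mu 0 V S \<and>
    (\<forall>i\<in>K. degrees_ok {x \<in> X. col x = i} sz (r i) 0 V S) \<and>
    (\<forall>i\<in>C. components_ok {x \<in> X. col x = i} sz (r i) 0 S lab)"
proof -
  have "\<exists>S (lab :: 'x \<Rightarrow> 'x). traces_ok X sz mu (card V - card U) U S \<and>
    (\<forall>i\<in>K. degrees_ok {x \<in> X. col x = i} sz (r i) (card V - card U) U S) \<and>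
    (\<forall>i\<in>C. components_ok {x \<in> X. col x = i} sz (r i) (card V - card U) S lab)" if "U \<subseteq> V" for U
  proof -
    have "finite U" using that fin(2) finite_subset by blast
    then show ?thesis using that
    proof (induction U)
      case empty
      have "traces_ok X sz mu (card V) {} (\<lambda>_. {})" using types by (simp add: traces_ok_def)
      moreover have "degrees_ok {x \<in> X. col x = i} sz (r i) (card V) {} (\<lambda>_. {})" if "i \<in> K" for i
        using sizes[OF that] by (simp add: degrees_ok_def)
      moreover have "components_ok {x \<in> X. col x = i} sz (r i) (card V) (\<lambda>_. {}) (\<lambda>x. x)" if "i \<in> C" for i
        using few[OF that] pos unfolding components_ok_def by force
      ultimately show ?case by auto
    next
      case (insert u U)
      then obtain S and lab :: "'x \<Rightarrow> 'x" where *: "traces_ok X sz mu (card V - card U) U S"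
        "\<And>i. i \<in> K \<Longrightarrow> degrees_ok {x \<in> X. col x = i} sz (r i) (card V - card U) U S"
        "\<And>i. i \<in> C \<Longrightarrow> components_ok {x \<in> X. col x = i} sz (r i) (card V - card U) S lab" by blast
      have "card (insert u U) \<le> card V" using insert.prems fin(2) by (rule card_mono[rotated])
      then have eq: "card V - card U = Suc (card V - card (insert u U))"
        using insert.hyps by simp
      show ?case
        by (rule detach_vertex[OF fin(1) insert.hyps(1,2) *[unfolded eq] CK r])
    qed
  qed
  from this[of V] show ?thesis by simp
qed

section \<open>Necessity of the conditions\<close>

lemma hdegree_sum: "hdegree (\<Sum>i\<in>I. F i) v = (\<Sum>i\<in>I. hdegree (F i) v)"
  unfolding hdegree_def by (induction I rule: infinite_finite_induct) auto

lemma edges_of_size_sum: "edges_of_size (\<Sum>i\<in>I. F i) s = (\<Sum>i\<in>I. edges_of_size (F i) s)"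
  unfolding edges_of_size_def by (induction I rule: infinite_finite_induct) auto

lemma hdegree_repeat_mset: "hdegree (repeat_mset k E) v = k * hdegree E v"
  unfolding hdegree_def by (induction k) auto

lemma edges_of_size_repeat_mset: "edges_of_size (repeat_mset k E) s = k * edges_of_size E s"
  unfolding edges_of_size_def by (induction k) auto

text \<open>The subsets avoiding \<open>v\<close> are removed from all subsets of size
  \<open>h\<close>, and Pascal's rule evaluates the difference.\<close>

lemma card_subsets_containing:
  assumes "finite V" "v \<in> V" "h \<ge> 1"
  shows "card {e. e \<subseteq> V \<and> card e = h \<and> v \<in> e} = (card V - 1) choose (h - 1)"
proof -
  have "{e. e \<subseteq> V \<and> card e = h \<and> v \<in> e} = {e. e \<subseteq> V \<and> card e = h} - {e. e \<subseteq> V - {v} \<and> card e = h}"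
    by auto
  moreover have "card ({e. e \<subseteq> V \<and> card e = h} - {e. e \<subseteq> V - {v} \<and> card e = h})
      = (card V choose h) - ((card V - 1) choose h)"
    using assms n_subsets[of V h] n_subsets[of "V - {v}" h]
    by (subst card_Diff_subset) auto
  moreover obtain n h' where "card V = Suc n" "h = Suc h'"
    using assms by (metis One_nat_def Suc_le_D card_Suc_Diff1)
  ultimately show ?thesis by simp
qed

lemma hdegree_complete:
  assumes "finite V" "v \<in> V" "\<And>i. i \<in> {1..m} \<Longrightarrow> h i \<ge> 1"
  shows "hdegree (complete_hypergraph V m lam h) v
    = (\<Sum>i\<in>{1..m}. lam i * ((card V - 1) choose (h i - 1)))"
proof -
  have "hdegree (mset_set {e. e \<subseteq> V \<and> card e = h i}) v = (card V - 1) choose (h i - 1)"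
    if "i \<in> {1..m}" for i
    using card_subsets_containing[OF assms(1,2) assms(3)[OF that]] assms(1)
    by (simp add: hdegree_def conj_assoc)
  then show ?thesis
    unfolding complete_hypergraph_def hdegree_sum hdegree_repeat_mset by (intro sum.cong) auto
qed

lemma edges_of_size_complete:
  assumes "finite V" "inj_on h {1..m}" "j \<in> {1..m}"
  shows "edges_of_size (complete_hypergraph V m lam h) (h j) = lam j * (card V choose h j)"
proof -
  have "edges_of_size (mset_set {e. e \<subseteq> V \<and> card e = h i}) (h j) = (if i = j then card V choose h j else 0)"
    if "i \<in> {1..m}" for i
  proof -
    have "h i = h j \<longleftrightarrow> i = j" using assms that by (auto dest: inj_onD)
    then have "{e. (e \<subseteq> V \<and> card e = h i) \<and> card e = h j} = (if i = j then {e. e \<subseteq> V \<and> card e = h j} else {})"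
      by auto
    then show ?thesis using assms(1) n_subsets[of V "h j"] by (simp add: edges_of_size_def)
  qed
  then have "edges_of_size (complete_hypergraph V m lam h) (h j)
      = (\<Sum>i\<in>{1..m}. if i = j then lam j * (card V choose h j) else 0)"
    unfolding complete_hypergraph_def edges_of_size_sum edges_of_size_repeat_mset
    by (intro sum.cong) auto
  then show ?thesis using assms(3) by simp
qed

lemma count_complete:
  assumes "finite V"
  shows "count (complete_hypergraph V m lam h) T
    = (if T \<subseteq> V then \<Sum>i\<in>{1..m}. if h i = card T then lam i else 0 else 0)"
proof -
  have "finite {e. e \<subseteq> V \<and> card e = s}" for s using assms by simp
  then have "count (complete_hypergraph V m lam h) T
      = (\<Sum>i\<in>{1..m}. if T \<subseteq> V \<and> h i = card T then lam i else 0)"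
    unfolding complete_hypergraph_def count_sum
    by (intro sum.cong) (auto simp: count_mset_set')
  then show ?thesis by (cases "T \<subseteq> V") auto
qed

lemma in_complete:
  assumes "finite V" "e \<in># complete_hypergraph V m lam h"
  shows "e \<subseteq> V \<and> (\<exists>j\<in>{1..m}. card e = h j)"
proof -
  have "count (complete_hypergraph V m lam h) e \<noteq> 0" using assms(2) by simp
  then have *: "e \<subseteq> V" "(\<Sum>i\<in>{1..m}. if h i = card e then lam i else 0) \<noteq> 0"
    unfolding count_complete[OF assms(1)] by (meson, meson)
  from *(2) obtain j where "j \<in> {1..m}" "(if h j = card e then lam j else 0) \<noteq> 0"
    by (rule sum.not_neutral_contains_not_neutral)
  then show ?thesis using *(1) by (metis (full_types))
qed

section \<open>Double counting of incidences and the edge bound for connected hypergraphs\<close>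

lemma sum_hdegree:
  assumes "finite V" "\<And>e. e \<in># E \<Longrightarrow> e \<subseteq> V"
  shows "(\<Sum>v\<in>V. hdegree E v) = (\<Sum>e\<in>#E. card e)"
  using assms(2)
proof (induction E)
  case (add e E)
  have "hdegree (add_mset e E) v = (if v \<in> e then 1 else 0) + hdegree E v" for v
    by (simp add: hdegree_def)
  then have "(\<Sum>v\<in>V. hdegree (add_mset e E) v) = card (V \<inter> e) + (\<Sum>v\<in>V. hdegree E v)"
    using assms(1) by (simp add: sum.distrib sum.If_cases Int_def)
  moreover have "V \<inter> e = e" using add.prems by auto
  ultimately show ?case using add by simp
qed (simp add: hdegree_def)

text \<open>The weight \<open>w\<close> is taken as the identity to count incidences and as 1 to
  count edges.\<close>

lemma sum_edges_of_size:
  assumes "finite J" "inj_on h J" "\<And>e. e \<in># E \<Longrightarrow> \<exists>j\<in>J. card e = h j"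
  shows "(\<Sum>j\<in>J. edges_of_size E (h j) * w (h j)) = (\<Sum>e\<in>#E. w (card e))"
  using assms(3)
proof (induction E)
  case (add e E)
  obtain i where i: "i \<in> J" "card e = h i" using add.prems by auto
  have "edges_of_size (add_mset e E) (h j) * w (h j)
      = (if j = i then w (h i) else 0) + edges_of_size E (h j) * w (h j)" if "j \<in> J" for j
    using i that assms(2) by (auto simp: edges_of_size_def dest: inj_onD)
  then have "(\<Sum>j\<in>J. edges_of_size (add_mset e E) (h j) * w (h j))
      = w (h i) + (\<Sum>j\<in>J. edges_of_size E (h j) * w (h j))"
    using assms(1) i by (simp add: sum.distrib)
  then show ?case using add i by simp
qed (simp add: edges_of_size_def)

text \<open>The classes of \<open>g\<close> stand for components. Adding an edge \<open>e\<close>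
  unites at most \<open>card e\<close> classes, so their number drops by at most
  \<open>card e - 1\<close>.\<close>

lemma component_map_exists:
  fixes V :: "'a set"
  assumes "finite V" "\<And>e. e \<in># E \<Longrightarrow> e \<subseteq> V \<and> e \<noteq> {}"
  shows "\<exists>g :: 'a \<Rightarrow> 'a. (\<forall>e x y. e \<in># E \<longrightarrow> x \<in> e \<longrightarrow> y \<in> e \<longrightarrow> g x = g y) \<and>
    card V + size E \<le> card (g ` V) + (\<Sum>e\<in>#E. card e)"
  using assms(2)
proof (induction E)
  case empty
  show ?case by (intro exI[of _ "\<lambda>x. x"]) auto
next
  case (add e E)
  then obtain g :: "'a \<Rightarrow> 'a" where g: "\<And>e x y. e \<in># E \<Longrightarrow> x \<in> e \<Longrightarrow> y \<in> e \<Longrightarrow> g x = g y"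
    "card V + size E \<le> card (g ` V) + (\<Sum>e\<in>#E. card e)" by force
  obtain a where a: "a \<in> e" and eV: "e \<subseteq> V" using add.prems by auto
  have fe: "finite e" using eV assms(1) finite_subset by blast
  define g' where "g' = (\<lambda>v. if g v \<in> g ` e then g a else g v)"
  have "insert (g a) (g ` V - g ` e) \<subseteq> g' ` V"
    using a eV by (force simp: g'_def)
  then have "card (insert (g a) (g ` V - g ` e)) \<le> card (g' ` V)"
    using assms(1) by (intro card_mono) auto
  moreover have "card (insert (g a) (g ` V - g ` e)) = Suc (card (g ` V - g ` e))"
    using assms(1) a by (subst card_insert_disjoint) auto
  moreover have "card (g ` V) \<le> card (g ` V - g ` e) + card (g ` e)"
    using fe diff_card_le_card_Diff[of "g ` e" "g ` V"] by simp
  moreover have "card (g ` e) \<le> card e" using fe by (rule card_image_le)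
  ultimately have "card V + size (add_mset e E) \<le> card (g' ` V) + (\<Sum>e\<in>#add_mset e E. card e)"
    using g(2) by simp
  moreover have "g' x = g' y" if "e' \<in># add_mset e E" "x \<in> e'" "y \<in> e'" for e' x y
  proof (cases "e' \<in># E")
    case True
    then show ?thesis using g(1)[OF True that(2,3)] by (simp add: g'_def)
  next
    case False
    then show ?thesis using that by (simp add: g'_def)
  qed
  ultimately show ?case by blast
qed

text \<open>The analogue of a connected graph having at least \<open>card V - 1\<close> edges: an
  edge of size \<open>s\<close> counts like a tree with \<open>s - 1\<close> edges. By connectedness
  a map constant on every edge is constant on \<open>V\<close>.\<close>

lemma hconnected_size_bound:
  assumes "finite V" "\<And>e. e \<in># E \<Longrightarrow> e \<subseteq> V \<and> e \<noteq> {}" "hconnected V E"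
  shows "card V + size E \<le> 1 + (\<Sum>e\<in>#E. card e)"
proof -
  obtain g :: "'a \<Rightarrow> 'a" where g: "\<And>e x y. e \<in># E \<Longrightarrow> x \<in> e \<Longrightarrow> y \<in> e \<Longrightarrow> g x = g y"
    "card V + size E \<le> card (g ` V) + (\<Sum>e\<in>#E. card e)"
    using component_map_exists[OF assms(1,2)] by blast
  have "g u = g v" if "(u, v) \<in> {(x, y). \<exists>e. e \<in># E \<and> x \<in> e \<and> y \<in> e}\<^sup>*" for u v
    using that by (induction rule: rtrancl_induct) (use g(1) in auto)
  then have const: "g u = g v" if "u \<in> V" "v \<in> V" for u v
    using assms(3) that unfolding hconnected_def by blast
  have "card (g ` V) \<le> Suc 0"
    by (subst card_le_Suc0_iff_eq) (use assms(1) in simp, use const in blast)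
  then show ?thesis using g(2) by simp
qed

lemma degree_condition_necessary:
  assumes fin: "finite V" "card V = n" "n \<ge> 1" and h: "\<And>i. i \<in> {1..m} \<Longrightarrow> h i \<ge> 1"
    and F: "is_factorization V (complete_hypergraph V m lam h) k r F"
  shows "degree_condition n m k lam h r"
proof -
  obtain v where v: "v \<in> V" using fin by fastforce
  have "(\<Sum>i\<in>{1..m}. lam i * ((n - 1) choose (h i - 1))) = hdegree (\<Sum>i\<in>{1..k}. F i) v"
    using F hdegree_complete[OF fin(1) v h] fin(2) unfolding is_factorization_def by simp
  also have "\<dots> = (\<Sum>i\<in>{1..k}. r i)"
    unfolding hdegree_sum using F v by (intro sum.cong) (auto simp: is_factorization_def is_factor_def)
  finally show ?thesis by (simp add: degree_condition_def)
qed

lemma matrix_condition_necessary: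
  assumes fin: "finite V" "card V = n" and inj: "inj_on h {1..m}"
    and F: "is_factorization V (complete_hypergraph V m lam h) k r F"
  shows "matrix_condition n m k lam h r (\<lambda>i j. edges_of_size (F i) (h j))"
proof -
  have "(\<Sum>j\<in>{1..m}. edges_of_size (F i) (h j) * h j) = n * r i" if i: "i \<in> {1..k}" for i
  proof -
    have fac: "is_factor V (complete_hypergraph V m lam h) (r i) (F i)"
      using F i unfolding is_factorization_def by auto
    then have sub: "e \<subseteq> V \<and> (\<exists>j\<in>{1..m}. card e = h j)" if "e \<in># F i" for e
      using that in_complete[OF fin(1)] unfolding is_factor_def by (meson mset_subset_eqD)
    have "(\<Sum>j\<in>{1..m}. edges_of_size (F i) (h j) * h j) = (\<Sum>e\<in>#F i. card e)"
      using sum_edges_of_size[OF _ inj, of "F i" "\<lambda>s. s"] sub by auto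
    also have "\<dots> = (\<Sum>v\<in>V. hdegree (F i) v)" using sum_hdegree[OF fin(1), of "F i"] sub by auto
    also have "\<dots> = n * r i" using fac fin(2) unfolding is_factor_def by simp
    finally show ?thesis .
  qed
  moreover have "(\<Sum>i\<in>{1..k}. edges_of_size (F i) (h j)) = lam j * (n choose h j)" if "j \<in> {1..m}" for j
    using edges_of_size_complete[OF fin(1) inj that, of lam] F fin(2)
    unfolding is_factorization_def edges_of_size_sum[symmetric] by simp
  ultimately show ?thesis unfolding matrix_condition_def by blast
qed

text \<open>An \<open>r\<close>-factor has \<open>n * r\<close> incidences, which turns
  \<open>hconnected_size_bound\<close> into this bound.\<close>

lemma connected_factor_bound:
  assumes fin: "finite V" "card V = n" and inj: "inj_on h {1..m}"
    and h: "\<And>i. i \<in> {1..m} \<Longrightarrow> h i \<ge> 1" and r: "r \<ge> 1"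
    and F: "is_factor V (complete_hypergraph V m lam h) r F" and con: "hconnected V F"
  shows "(\<Sum>j\<in>{1..m}. edges_of_size F (h j)) \<le> n * (r - 1) + 1"
proof -
  have sub: "e \<subseteq> V \<and> (\<exists>j\<in>{1..m}. card e = h j)" if "e \<in># F" for e
    using that F in_complete[OF fin(1)] unfolding is_factor_def by (meson mset_subset_eqD)
  have ne: "e \<subseteq> V \<and> e \<noteq> {}" if "e \<in># F" for e
    using sub[OF that] h by force
  have "(\<Sum>j\<in>{1..m}. edges_of_size F (h j)) = size F"
    using sum_edges_of_size[OF _ inj, of F "\<lambda>s. 1"] sub by simp
  moreover have "(\<Sum>e\<in>#F. card e) = n * r"
    using sum_hdegree[OF fin(1), of F] sub F fin(2) unfolding is_factor_def by simp
  moreover obtain r' where "r = Suc r'" using r by (cases r) auto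
  ultimately show ?thesis using hconnected_size_bound[OF fin(1) ne con] fin(2) by simp
qed

section \<open>Construction of the factorization\<close>

lemma count_image_mset_mset_set:
  "finite Y \<Longrightarrow> count (image_mset S (mset_set Y)) T = card {x \<in> Y. S x = T}"
proof (induction Y rule: finite_induct)
  case (insert a Y)
  have "{x \<in> insert a Y. S x = T} = (if S a = T then insert a {x \<in> Y. S x = T} else {x \<in> Y. S x = T})"
    by auto
  then show ?case using insert by simp
qed simp

lemma size_filter_image_mset_set:
  "finite Y \<Longrightarrow> size {#e \<in># image_mset S (mset_set Y). P e#} = card {x \<in> Y. P (S x)}"
  by (simp add: filter_mset_image_mset)

text \<open>Turns links between edges into walks between vertices: a vertex shared by consecutive
  edges is where the walk changes from one to the next.\<close>

lemma hconnected_image: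
  assumes links: "\<And>x y. x \<in> Y \<Longrightarrow> y \<in> Y \<Longrightarrow> (x, y) \<in> (edge_links Y S)\<^sup>*"
    and fin: "finite Y" and cover: "\<And>v. v \<in> V \<Longrightarrow> \<exists>x\<in>Y. v \<in> S x"
  shows "hconnected V (image_mset S (mset_set Y))"
proof -
  let ?R = "{(p, q). \<exists>e. e \<in># image_mset S (mset_set Y) \<and> p \<in> e \<and> q \<in> e}"
  have R: "(p, q) \<in> ?R" if "x \<in> Y" "p \<in> S x" "q \<in> S x" for x p q
    using that fin by auto
  have walk: "p \<in> S x \<Longrightarrow> q \<in> S y \<Longrightarrow> (p, q) \<in> ?R\<^sup>*"
    if "(x, y) \<in> (edge_links Y S)\<^sup>*" "x \<in> Y" for x y p q
    using that
  proof (induction arbitrary: q rule: rtrancl_induct)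
    case base
    then show ?case using R by blast
  next
    case (step y z)
    obtain s where "s \<in> S y" "s \<in> S z" "z \<in> Y" using step.hyps(2) unfolding edge_links_def by blast
    then have "(p, s) \<in> ?R\<^sup>*" "(s, q) \<in> ?R" using step.IH step.prems R by blast+
    then show ?case by (rule rtrancl_into_rtrancl)
  qed
  show ?thesis unfolding hconnected_def
  proof (intro ballI)
    fix u v assume "u \<in> V" "v \<in> V"
    then obtain x y where "x \<in> Y" "u \<in> S x" "y \<in> Y" "v \<in> S y" using cover by meson
    then show "(u, v) \<in> ?R\<^sup>*" using walk links by blast
  qed
qed

lemma factorization_from_matrix:
  fixes V :: "'a set"
  assumes fin: "finite V" "card V = n"
    and r: "\<And>i. i \<in> {1..k} \<Longrightarrow> r i \<ge> 1"
    and h: "\<And>j. j \<in> {1..m} \<Longrightarrow> h j \<ge> 1" and inj: "inj_on h {1..m}"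
    and A: "matrix_condition n m k lam h r A"
  shows "\<exists>F. is_factorization V (complete_hypergraph V m lam h) k r F \<and>
    (\<forall>i\<in>{1..k}. \<forall>j\<in>{1..m}. edges_of_size (F i) (h j) = A i j) \<and>
    (\<forall>i\<in>{1..k}. (\<Sum>j\<in>{1..m}. A i j) \<le> n * (r i - 1) + 1 \<longrightarrow> hconnected V (F i))"
proof -
  \<comment> \<open>The triple \<open>(i, j, c)\<close> in \<open>X\<close> is copy \<open>c\<close>
    of the edges of size \<open>h j\<close> in colour \<open>i\<close>, still without
    vertices.\<close>
  define Z where "Z = (\<lambda>i. SIGMA j:{1..m}. {..<A i j})"
  define X where "X = (SIGMA i:{1..k}. Z i)"
  define sz :: "nat \<times> nat \<times> nat \<Rightarrow> nat" where "sz = (\<lambda>(i, j, c). h j)"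
  define Y where "Y = (\<lambda>i. {x \<in> X. fst x = i})"
  \<comment> \<open>The multiplicity of a vertex set of size \<open>s\<close>. As \<open>h\<close>
    is injective on the indices, at most one summand is nonzero; sizes that \<open>h\<close> does
    not take get 0.\<close>
  define mu where "mu = (\<lambda>s. \<Sum>j\<in>{1..m}. if h j = s then lam j else 0)"
  define C where "C = {i \<in> {1..k}. (\<Sum>j\<in>{1..m}. A i j) \<le> n * (r i - 1) + 1}"
  have finX: "finite X" by (simp add: X_def Z_def)
  then have finY: "finite (Y i)" for i by (simp add: Y_def)
  have Y: "Y i = Pair i ` Z i" if "i \<in> {1..k}" for i using that by (auto simp: Y_def X_def)
  have sumY: "(\<Sum>x\<in>Y i. w (sz x)) = (\<Sum>j\<in>{1..m}. A i j * w (h j))" if "i \<in> {1..k}" for i and w :: "nat \<Rightarrow> nat"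
  proof -
    have "(\<Sum>x\<in>Y i. w (sz x)) = (\<Sum>(j, c)\<in>Z i. w (h j))"
      unfolding Y[OF that] by (simp add: sum.reindex inj_on_def sz_def case_prod_unfold)
    also have "\<dots> = (\<Sum>j\<in>{1..m}. \<Sum>c<A i j. w (h j))"
      unfolding Z_def by (rule sum.Sigma[symmetric]) auto
    finally show ?thesis by simp
  qed
  have card_sz: "card {x \<in> Y i. sz x = s} = (\<Sum>j\<in>{1..m}. if h j = s then A i j else 0)"
    if "i \<in> {1..k}" for i s
  proof -
    have "card {x \<in> Y i. sz x = s} = (\<Sum>x\<in>Y i. if sz x = s then 1 else 0)"
      using finY by (simp add: sum.If_cases Int_def)
    also have "\<dots> = (\<Sum>j\<in>{1..m}. A i j * (if h j = s then 1 else 0))" by (rule sumY[OF that])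
    also have "\<dots> = (\<Sum>j\<in>{1..m}. if h j = s then A i j else 0)" by (rule sum.cong) auto
    finally show ?thesis .
  qed
  have X_Y: "card {x \<in> X. P x} = (\<Sum>i\<in>{1..k}. card {x \<in> Y i. P x})" for P
  proof -
    have "card {x \<in> X. P x} = card (\<Union>i\<in>{1..k}. {x \<in> Y i. P x})"
      by (rule arg_cong[of _ _ card]) (auto simp: Y_def X_def)
    also have "\<dots> = (\<Sum>i\<in>{1..k}. card {x \<in> Y i. P x})"
      using finX by (intro card_UN_disjoint) (auto simp: Y_def)
    finally show ?thesis .
  qed
  have "card {x \<in> X. sz x = s} = mu s * (card V choose s)" for s
  proof -
    have "card {x \<in> X. sz x = s} = (\<Sum>i\<in>{1..k}. \<Sum>j\<in>{1..m}. if h j = s then A i j else 0)"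
      unfolding X_Y by (intro sum.cong card_sz) auto
    also have "\<dots> = (\<Sum>j\<in>{1..m}. \<Sum>i\<in>{1..k}. if h j = s then A i j else 0)" by (rule sum.swap)
    also have "\<dots> = (\<Sum>j\<in>{1..m}. (if h j = s then lam j else 0) * (n choose s))"
      using A unfolding matrix_condition_def by (intro sum.cong) auto
    finally show ?thesis by (simp add: mu_def sum_distrib_right fin(2))
  qed
  moreover have "(\<Sum>x | x \<in> X \<and> fst x = i. sz x) = card V * r i" if "i \<in> {1..k}" for i
    using sumY[OF that, of "\<lambda>s. s"] A that fin(2) unfolding matrix_condition_def Y_def by simp
  moreover have "sz x \<ge> 1" if "x \<in> X" for x using that h by (auto simp: X_def Z_def sz_def)
  moreover have "card {x \<in> X. fst x = i} \<le> card V * (r i - 1) + 1" if "i \<in> C" for i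
    using sumY[of i "\<lambda>_. 1"] that fin(2) by (simp add: C_def Y_def)
  moreover have "C \<subseteq> {1..k}" by (auto simp: C_def)
  ultimately obtain S and lab :: "nat \<times> nat \<times> nat \<Rightarrow> nat \<times> nat \<times> nat" where
    tr: "traces_ok X sz mu 0 V S" and
    dg: "\<And>i. i \<in> {1..k} \<Longrightarrow> degrees_ok (Y i) sz (r i) 0 V S" and
    co: "\<And>i. i \<in> C \<Longrightarrow> components_ok (Y i) sz (r i) 0 S lab"
    using detachment_exists[OF finX fin(1), of sz mu "{1..k}" fst r C] r unfolding Y_def by blast
  \<comment> \<open>At weight 0 no hinges remain, so every trace is the full edge.\<close>
  have card_S: "card (S x) = sz x" if "i \<in> {1..k}" "x \<in> Y i" for i x
  proof -
    have "(\<Sum>x\<in>Y i. sz x - card (S x)) = 0" using dg[OF that(1)] by (simp add: degrees_ok_def)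
    then have "\<forall>x\<in>Y i. sz x - card (S x) = 0" using finY[of i] by (simp only: sum_eq_0_iff)
    then have "sz x \<le> card (S x)" using that(2) by simp
    moreover have "x \<in> X" using that(2) by (simp add: Y_def)
    ultimately show ?thesis using tr unfolding traces_ok_def by (meson le_antisym)
  qed
  define F where "F = (\<lambda>i. image_mset S (mset_set (Y i)))"
  have sum_F: "(\<Sum>i\<in>{1..k}. F i) = complete_hypergraph V m lam h"
  proof (rule multiset_eqI)
    fix T
    have "count (\<Sum>i\<in>{1..k}. F i) T = card {x \<in> X. S x = T}"
      unfolding X_Y F_def by (simp add: count_sum count_image_mset_mset_set finY)
    also have "\<dots> = (if T \<subseteq> V then mu (card T) else 0)"
    proof (cases "T \<subseteq> V")
      case True
      have "card (S x) = sz x" if "x \<in> X" for x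
        using card_S[of "fst x" x] that by (auto simp: Y_def X_def)
      then have "{x \<in> X. S x = T} = {x \<in> X. S x = T \<and> sz x = card T}" by auto
      \<comment> \<open>At weight 0 the coefficient \<open>0 choose (s - card T)\<close> is 1 for
        \<open>s = card T\<close>, so the trace count is the multiplicity itself.\<close>
      then show ?thesis using tr True unfolding traces_ok_def by simp
    next
      case False
      then have none: "{x \<in> X. S x = T} = {}" using tr unfolding traces_ok_def by auto
      show ?thesis unfolding none using False by simp
    qed
    also have "\<dots> = count (complete_hypergraph V m lam h) T"
      unfolding count_complete[OF fin(1)] mu_def by simp
    finally show "count (\<Sum>i\<in>{1..k}. F i) T = count (complete_hypergraph V m lam h) T" .
  qed
  have "is_factor V (complete_hypergraph V m lam h) (r i) (F i)" if i: "i \<in> {1..k}" for i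
  proof -
    have "F i \<subseteq># complete_hypergraph V m lam h"
      unfolding sum_F[symmetric] using i by (simp add: sum.remove)
    then show ?thesis using dg[OF i] finY
      by (simp add: is_factor_def hdegree_def F_def size_filter_image_mset_set degrees_ok_def)
  qed
  then have "is_factorization V (complete_hypergraph V m lam h) k r F"
    using sum_F by (simp add: is_factorization_def)
  moreover have "edges_of_size (F i) (h j) = A i j" if ij: "i \<in> {1..k}" "j \<in> {1..m}" for i j
  proof -
    have "{x \<in> Y i. card (S x) = h j} = {x \<in> Y i. sz x = h j}" using card_S[OF ij(1)] by auto
    then have "edges_of_size (F i) (h j) = (\<Sum>j'\<in>{1..m}. if h j' = h j then A i j' else 0)"
      using card_sz[OF ij(1)] finY by (simp add: edges_of_size_def F_def size_filter_image_mset_set)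
    also have "\<dots> = (\<Sum>j'\<in>{1..m}. if j' = j then A i j' else 0)"
      using inj ij(2) by (intro sum.cong) (auto dest: inj_onD)
    finally show ?thesis using ij(2) by simp
  qed
  moreover have "hconnected V (F i)" if i: "i \<in> C" for i
    unfolding F_def
  proof (rule hconnected_image[OF _ finY])
    fix x y assume xy: "x \<in> Y i" "y \<in> Y i"
    \<comment> \<open>At weight 0 the bound on the number of labels is 1, so all edges of the colour
      are linked.\<close>
    have "card (lab ` Y i) \<le> Suc 0" using co[OF i] by (simp add: components_ok_def)
    then have "\<forall>a\<in>lab ` Y i. \<forall>b\<in>lab ` Y i. a = b"
      by (rule iffD1[OF card_le_Suc0_iff_eq[OF finite_imageI[OF finY]]])
    then have "lab x = lab y" using xy by blast
    then show "(x, y) \<in> (edge_links (Y i) S)\<^sup>*" using co[OF i] xy by (simp add: components_ok_def)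
  next
    fix v assume "v \<in> V"
    have iK: "i \<in> {1..k}" using i by (simp add: C_def)
    then have "card {x \<in> Y i. v \<in> S x} \<ge> 1" using dg[OF iK] r[OF iK] \<open>v \<in> V\<close> by (simp add: degrees_ok_def)
    then have "{x \<in> Y i. v \<in> S x} \<noteq> {}" by (metis card.empty not_one_le_zero)
    then show "\<exists>x\<in>Y i. v \<in> S x" by blast
  qed
  ultimately show ?thesis by (intro exI[of _ F]) (auto simp: C_def)
qed

theorem theorem9p1:
  fixes V :: "'a set" and n m k :: nat
    and lam h r :: "nat \<Rightarrow> nat"
  assumes "finite V" and "card V = n"
    and "n \<ge> 1" and "m \<ge> 1" and "k \<ge> 1"
    and "\<forall>i\<in>{1..m}. lam i \<ge> 1"
    and "\<forall>i\<in>{1..k}. r i \<ge> 1"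
    and "\<forall>i\<in>{1..m}. 1 \<le> h i \<and> h i \<le> n"
    and "strict_mono_on {1..m} h"
  shows "(factorable V (complete_hypergraph V m lam h) k r \<longleftrightarrow>
            degree_condition n m k lam h r \<and> (\<exists>A. matrix_condition n m k lam h r A)) \<and>
         (\<forall>F. is_factorization V (complete_hypergraph V m lam h) k r F \<longrightarrow>
            matrix_condition n m k lam h r (\<lambda>i j. edges_of_size (F i) (h j)) \<and>
            (\<forall>i\<in>{1..k}. hconnected V (F i) \<longrightarrow>
               (\<Sum>j\<in>{1..m}. edges_of_size (F i) (h j)) \<le> n * (r i - 1) + 1)) \<and>
         (\<forall>A. degree_condition n m k lam h r \<and> matrix_condition n m k lam h r A \<longrightarrow>
            (\<exists>F. is_factorization V (complete_hypergraph V m lam h) k r F \<and>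
               (\<forall>i\<in>{1..k}. \<forall>j\<in>{1..m}. edges_of_size (F i) (h j) = A i j) \<and>
               (\<forall>i\<in>{1..k}. (\<Sum>j\<in>{1..m}. A i j) \<le> n * (r i - 1) + 1 \<longrightarrow>
                  hconnected V (F i))))"
proof -
  let ?K = "complete_hypergraph V m lam h"
  have inj: "inj_on h {1..m}" using assms(9) by (rule strict_mono_on_imp_inj_on)
  have h: "h i \<ge> 1" if "i \<in> {1..m}" for i using assms(8) that by blast
  have r: "r i \<ge> 1" if "i \<in> {1..k}" for i using assms(7) that by blast
  have nec: "degree_condition n m k lam h r"
    "matrix_condition n m k lam h r (\<lambda>i j. edges_of_size (F i) (h j))"
    if "is_factorization V ?K k r F" for F
    using degree_condition_necessary[OF assms(1-3) h that] matrix_condition_necessary[OF assms(1,2) inj that]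
    by blast+
  have bound: "(\<Sum>j\<in>{1..m}. edges_of_size (F i) (h j)) \<le> n * (r i - 1) + 1"
    if "is_factorization V ?K k r F" "i \<in> {1..k}" "hconnected V (F i)" for F i
    using connected_factor_bound[OF assms(1,2) inj h r[OF that(2)] _ that(3)] that
    unfolding is_factorization_def by blast
  note suf = factorization_from_matrix[OF assms(1,2) r h inj]
  show ?thesis
  proof (intro conjI allI impI ballI)
    show "factorable V ?K k r \<longleftrightarrow> degree_condition n m k lam h r \<and> (\<exists>A. matrix_condition n m k lam h r A)"
      unfolding factorable_def using nec suf by fast
  qed (use nec(2) in blast, use bound in blast, elim conjE, rule suf)
qed

end
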